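(* Let $\mathfrak{O}$ be the valuation ring of a non-Archimedean local field of characteristic zero. Let $\mathfrak{g} \subset \mathfrak{gl}_d(\mathfrak{O})$ be a Lie subalgebra (over $\mathfrak{O}$). Then $\mathsf{Z}^{\mathsf{ask}}_{\mathfrak{g}}(T)$ has bounded denominators, i.e. there exists a non-zero $a \in \mathbf{Z}$ such that $a\,\mathsf{Z}^{\mathsf{ask}}_{\mathfrak{g}}(T) \in \mathbf{Z}[[T]]$.
   Context: $\mathfrak{gl}_d(\mathfrak{O})$ is $\mathrm{M}_d(\mathfrak{O})$ with Lie bracket $[a,b] = ab-ba$; a Lie subalgebra is an $\mathfrak{O}$-submodule closed under the bracket. Let $\mathfrak{P}$ be the maximal ideal of $\mathfrak{O}$ and $\mathfrak{O}_n = \mathfrak{O}/\mathfrak{P}^n$. Matrices act by right multiplication on row vectors: $a \in \mathrm{M}_{d}(R)$ gives the map $R^d \to R^d$, $x \mapsto xa$, with kernel $\mathrm{Ker}(a)$. For a finite ring $R$ and a submodule $N \subset \mathrm{M}_{d}(R)$, let $\mathrm{ask}(N) = |N|^{-1}\sum_{a\in N} |\mathrm{Ker}(a)|$. For an $\mathfrak{O}$-submodule $M \subset \mathrm{M}_{d}(\mathfrak{O})$, let $M_n \subset \mathrm{M}_{d}(\mathfrak{O}_n)$ be the image of $M$ under entrywise reduction modulo $\mathfrak{P}^n$. The ask zeta function of $M$ is $\mathsf{Z}^{\mathsf{ask}}_M(T) = \sum_{n=0}^\infty \mathrm{ask}(M_n)\, T^n \in \mathbf{Q}[[T]]$. *)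

theory Defs
  imports
    "HOL-Analysis.Abstract_Metric_Spaces"
    "HOL-Algebra.Algebraic_Closure_Type"
    "HOL-Algebra.Ideal_Product"
    "HOL-Algebra.QuotRing"
    "HOL-Computational_Algebra.Formal_Power_Series"
    "Jordan_Normal_Form.Matrix"
begin

text \<open>
  The local field is the type \<open>'k\<close> together with an absolute value \<open>v\<close>.
\<close>

definition valuation_ring :: "('k::field \<Rightarrow> real) \<Rightarrow> 'k ring" where
  "valuation_ring v = ring_of_type_algebra\<lparr>carrier := {x. v x \<le> 1}\<rparr>"

definition valuation_ideal :: "('k::field \<Rightarrow> real) \<Rightarrow> 'k set" where
  "valuation_ideal v = {x. v x < 1}"

text \<open>
  A non-Archimedean local field: complete with respect to a (non-trivial) discrete
  ultrametric absolute value, with finite residue field. The characteristic is not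
  restricted here; characteristic zero is expressed by the class \<open>field_char_0\<close> of \<open>'k\<close>.
\<close>

locale nonarch_local_field =
  fixes v :: "'k::field \<Rightarrow> real"
  assumes nonneg: "0 \<le> v x"
    and eq_zero_iff: "v x = 0 \<longleftrightarrow> x = 0"
    and mult: "v (x * y) = v x * v y"
    and ultrametric: "v (x + y) \<le> max (v x) (v y)"
    and discrete: "\<exists>r. 0 < r \<and> r < 1 \<and> v ` (UNIV - {0}) = range (\<lambda>k::int. r powi k)"
    and complete: "Metric_space.mcomplete UNIV (\<lambda>x y. v (x - y))"
    and finite_residue_field: "finite (carrier (valuation_ring v Quot valuation_ideal v))"

primrec ideal_power :: "('a, 'b) ring_scheme \<Rightarrow> 'a set \<Rightarrow> nat \<Rightarrow> 'a set" where
  "ideal_power R I 0 = carrier R"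
| "ideal_power R I (Suc n) = ideal_prod R I (ideal_power R I n)"

definition quotient_level :: "('k::field \<Rightarrow> real) \<Rightarrow> nat \<Rightarrow> 'k set ring" where
  "quotient_level v n = valuation_ring v Quot ideal_power (valuation_ring v) (valuation_ideal v) n"

definition matrix_module :: "('k::field, 'b) ring_scheme \<Rightarrow> nat \<Rightarrow> ('k, 'k mat) module" where
  "matrix_module R d =
     (module_mat TYPE('k) d d)\<lparr>carrier := {a \<in> carrier_mat d d. elements_mat a \<subseteq> carrier R}\<rparr>"

text \<open>
  The ring \<open>R\<close> is meant to be a subring of the field \<open>'k\<close>, so that the operations of \<open>'k mat\<close>
  are those of matrices over \<open>R\<close>.
\<close>

definition lie_subalgebra_gl :: "('k::field, 'b) ring_scheme \<Rightarrow> nat \<Rightarrow> 'k mat set \<Rightarrow> bool" where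
  "lie_subalgebra_gl R d L \<longleftrightarrow>
     submodule L R (matrix_module R d) \<and> (\<forall>a\<in>L. \<forall>b\<in>L. a * b - b * a \<in> L)"

text \<open>
  The elements of \<open>R\<close> need not form a type with ring operations (below, \<open>R\<close> is a quotient ring
  whose elements are cosets), so the row vector \<open>xa\<close> is spelled out with the operations of \<open>R\<close>.
\<close>

definition left_kernel :: "('r, 'b) ring_scheme \<Rightarrow> nat \<Rightarrow> 'r mat \<Rightarrow> 'r vec set" where
  "left_kernel R d a =
     {x \<in> carrier_vec d. (\<forall>i<d. vec_index x i \<in> carrier R) \<and>
        (\<forall>j<d. (\<Oplus>\<^bsub>R\<^esub>i\<in>{..<d}. vec_index x i \<otimes>\<^bsub>R\<^esub> (a $$ (i, j))) = \<zero>\<^bsub>R\<^esub>)}"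

definition ask :: "('r, 'b) ring_scheme \<Rightarrow> nat \<Rightarrow> 'r mat set \<Rightarrow> rat" where
  "ask R d N = (\<Sum>a\<in>N. of_nat (card (left_kernel R d a))) / of_nat (card N)"

definition reduction :: "('k::field \<Rightarrow> real) \<Rightarrow> nat \<Rightarrow> 'k mat \<Rightarrow> 'k set mat" where
  "reduction v n =
     map_mat (\<lambda>x. ideal_power (valuation_ring v) (valuation_ideal v) n +>\<^bsub>valuation_ring v\<^esub> x)"

definition ask_zeta :: "('k::field \<Rightarrow> real) \<Rightarrow> nat \<Rightarrow> 'k mat set \<Rightarrow> rat fps" where
  "ask_zeta v d M = Abs_fps (\<lambda>n. ask (quotient_level v n) d (reduction v n ` M))"

definition bounded_denominators :: "rat fps \<Rightarrow> bool" where
  "bounded_denominators F \<longleftrightarrow>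
     (\<exists>a::int. a \<noteq> 0 \<and> (\<forall>n. fps_nth (fps_const (of_int a) * F) n \<in> \<int>))"

end

theory Submission
  imports Defs "HOL-Library.Function_Algebras" "HOL-Library.Set_Algebras"
begin

text \<open>
  Write \<open>V\<close> for the lattice of row vectors with entries in the valuation ring, \<open>M\<close> for the
  matrices with such entries, acting by \<open>x \<mapsto> xa\<close> in this overview, \<open>\<g>\<close> for the Lie algebra, \<open>V\<^sub>n\<close> for the vectors with entries in the
  \<open>n\<close>-th power of the maximal ideal, and fix an integer \<open>q > 0\<close> in the maximal ideal. Counting the
  pairs \<open>(x, a)\<close> with \<open>xa = 0\<close> over the quotient ring in two ways turns the average size of the
  kernel into the sum of \<open>1 / |x\<g> mod V\<^sub>n|\<close> over \<open>x \<in> V / V\<^sub>n\<close>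
  (\<open>average_kernel_eq_sum_inverse_card\<close>). Such a sum is an integer as soon as some group acts on
  the finite set of vectors so that \<open>|x\<g>|\<close> is constant on every orbit and divides its length.

  The group generated by the exponentials of \<open>q\<^sup>2\<g>\<close> is the obvious candidate, but its orbits
  are controlled by the Baker-Campbell-Hausdorff formula. A larger group avoids this formula. Put
  \<open>h = q\<^sup>2\<g>\<close> and \<open>H = h + q\<^sup>nM\<close>, let \<open>N\<close> be the group of all \<open>y \<in> 1 + q\<^sup>2M\<close> with
  \<open>y\<^sup>-\<^sup>1by - b \<in> q\<^sup>2H\<close> for \<open>b \<in> H\<close>, and let \<open>\<n>\<close> be the additive group of all \<open>a \<in> q\<^sup>2M\<close>
  with \<open>[a, H] \<subseteq> q\<^sup>2H\<close>. Both are defined by conditions that make it plain that they are groups;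
  \<open>h \<subseteq> \<n>\<close> because \<open>\<g>\<close> is a Lie algebra; and \<open>|xh|\<close> is constant on the orbits of \<open>N\<close>
  because \<open>N\<close> normalises \<open>H\<close>. What remains is that the orbit of \<open>x\<close> under \<open>N\<close> has exactly as
  many elements as \<open>x\<n>\<close>, which is a multiple of \<open>|xh|\<close> by Lagrange's theorem.

  To compare orbits of \<open>N\<close> with the images \<open>x\<n>\<close>, the logarithm is replaced by the difference
  quotient \<open>(y\<^sup>P - 1) / P\<close> with \<open>P\<close> a high power of \<open>q\<close>: this needs only integers and
  torsion-freeness, no convergent series. It is a bijection from \<open>1 + q\<^sup>2M\<close> to \<open>q\<^sup>2M\<close> modulo
  every power of \<open>q\<close>, since it is an isometry between finite sets of equal size
  (\<open>ex_lg_cong\<close>). It carries \<open>N\<close> to \<open>\<n>\<close> and the stabiliser of \<open>x\<close> to the annihilator of \<open>x\<close>.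
  Both facts are instances of one lemma about an operator \<open>T\<close> close to the identity: \<open>T\<^sup>q - 1\<close> maps
  \<open>S\<close> into \<open>qU\<close> if and only if \<open>T - 1\<close> maps \<open>S\<close> into \<open>U\<close>
  (\<open>power_root_subgroup_iff\<close>). For \<open>N\<close> it is applied to conjugation by \<open>y\<close>, as an operator on
  \<open>M\<close>; for the stabiliser, to \<open>y\<close> itself, as an operator on \<open>V\<close>.

  Finally, replacing \<open>\<g>\<close> by \<open>q\<^sup>2\<g>\<close> and \<open>V\<^sub>n\<close> by \<open>q\<^sup>2V\<^sub>n\<close> multiplies the sum by
  \<open>|V\<^sub>n / q\<^sup>2V\<^sub>n| = |V / q\<^sup>2V|\<close>. This number does not depend on \<open>n\<close> and is the common denominator.
\<close>

section \<open>Additive subgroups and their multiples\<close>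

definition add_subgroup :: "'a::ab_group_add set \<Rightarrow> bool" where
  "add_subgroup G \<longleftrightarrow> 0 \<in> G \<and> (\<forall>x\<in>G. \<forall>y\<in>G. x - y \<in> G)"

lemma add_subgroupI:
  assumes "0 \<in> G" "\<And>x y. x \<in> G \<Longrightarrow> y \<in> G \<Longrightarrow> x - y \<in> G"
  shows "add_subgroup G"
  using assms by (simp add: add_subgroup_def)

context
  fixes G :: "'a::ab_group_add set"
  assumes G: "add_subgroup G"
begin

lemma add_subgroup_zero: "0 \<in> G"
  using G by (simp add: add_subgroup_def)

lemma add_subgroup_diff: "x \<in> G \<Longrightarrow> y \<in> G \<Longrightarrow> x - y \<in> G"
  using G by (simp add: add_subgroup_def)

lemma add_subgroup_uminus: "x \<in> G \<Longrightarrow> - x \<in> G"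
  using add_subgroup_diff[of 0 x] add_subgroup_zero by simp

lemma add_subgroup_add: "x \<in> G \<Longrightarrow> y \<in> G \<Longrightarrow> x + y \<in> G"
  using add_subgroup_diff[of x "- y"] add_subgroup_uminus by simp

lemma add_subgroup_sum: "(\<And>i. i \<in> I \<Longrightarrow> f i \<in> G) \<Longrightarrow> sum f I \<in> G"
  by (induction I rule: infinite_finite_induct) (auto intro: add_subgroup_zero add_subgroup_add)

end

lemma add_subgroup_of_nat_mult:
  fixes G :: "'a::ring_1 set"
  assumes "add_subgroup G" "x \<in> G"
  shows "of_nat n * x \<in> G"
  by (induction n) (auto simp: algebra_simps intro: assms add_subgroup_zero add_subgroup_add)

lemma add_subgroup_set_plus:
  assumes "add_subgroup G" "add_subgroup G'"
  shows "add_subgroup (G + G')"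
proof (rule add_subgroupI)
  show "0 \<in> G + G'"
    using set_plus_intro[OF add_subgroup_zero[OF assms(1)] add_subgroup_zero[OF assms(2)]] by simp
next
  fix x y assume "x \<in> G + G'" "y \<in> G + G'"
  then obtain a b c e where "x = a + b" "y = c + e" "a \<in> G" "b \<in> G'" "c \<in> G" "e \<in> G'"
    by (elim set_plus_elim)
  moreover have "a + b - (c + e) = (a - c) + (b - e)" by simp
  ultimately show "x - y \<in> G + G'"
    by (metis add_subgroup_diff assms set_plus_intro)
qed

text \<open>
  Multiplication by the integer \<open>n\<close> is written as multiplication by \<open>of_nat n\<close>, so groups are taken
  inside additive groups of unital rings. The row vectors get the pointwise ring structure for this
  purpose only.
\<close>

definition multiples :: "nat \<Rightarrow> 'a::ring_1 set \<Rightarrow> 'a set" where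
  "multiples n G = (\<lambda>x. of_nat n * x) ` G"

lemma multiplesI: "x \<in> G \<Longrightarrow> of_nat n * x \<in> multiples n G"
  by (auto simp: multiples_def)

lemma multiplesE: 
  assumes "x \<in> multiples n G" obtains y where "y \<in> G" "x = of_nat n * y"
  using assms by (auto simp: multiples_def)

lemma multiples_mono: "G \<subseteq> G' \<Longrightarrow> multiples n G \<subseteq> multiples n G'"
  by (auto simp: multiples_def)

lemma multiples_1 [simp]: "multiples 1 G = G" "multiples (Suc 0) G = G"
  by (auto simp: multiples_def)

lemma multiples_multiples: "multiples m (multiples n G) = multiples (m * n) G"
  by (auto simp: multiples_def image_image mult.assoc)

lemma add_subgroup_multiples:
  assumes "add_subgroup G" shows "add_subgroup (multiples n G)"
proof (rule add_subgroupI)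
  show "0 \<in> multiples n G"
    using multiplesI[OF add_subgroup_zero[OF assms], of n] by simp
  fix x y assume "x \<in> multiples n G" "y \<in> multiples n G"
  thus "x - y \<in> multiples n G"
    by (auto elim!: multiplesE simp: right_diff_distrib [symmetric] intro!: multiplesI add_subgroup_diff[OF assms])
qed

lemma multiples_subset: "add_subgroup G \<Longrightarrow> multiples n G \<subseteq> G"
  by (auto simp: multiples_def add_subgroup_of_nat_mult)

lemma multiples_mult_subset: "add_subgroup G \<Longrightarrow> multiples (m * n) G \<subseteq> multiples m G"
  by (metis multiples_multiples multiples_mono multiples_subset)

lemma multiples_power_mono: "add_subgroup G \<Longrightarrow> k \<le> l \<Longrightarrow> multiples (q ^ l) G \<subseteq> multiples (q ^ k) G"
  by (metis le_Suc_ex multiples_mult_subset power_add)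

lemma multiples_set_plus: "multiples n (A + B) = multiples n A + multiples n B"
proof
  show "multiples n (A + B) \<subseteq> multiples n A + multiples n B"
    by (auto elim!: multiplesE set_plus_elim simp: distrib_left intro!: set_plus_intro multiplesI)
  show "multiples n A + multiples n B \<subseteq> multiples n (A + B)"
    by (auto elim!: multiplesE set_plus_elim simp: distrib_left[symmetric] intro!: set_plus_intro multiplesI)
qed

section \<open>The ring of additive endomorphisms\<close>

text \<open>
  A type of endomorphisms can be iterated: conjugation by an endomorphism of \<open>V\<close> is an
  endomorphism of the additive group of the endomorphism ring, and one set of lemmas on powers of
  operators covers both.
\<close>

typedef (overloaded) 'a endo = "{f :: 'a::ring_1 \<Rightarrow> 'a. \<forall>x y. f (x + y) = f x + f y}"
  morphisms app Endo
  by (rule exI[of _ "\<lambda>x. x"]) simp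

lemma app_add: "app f (x + y) = app f x + app f y"
  using app[of f] by simp

lemma app_Endo: "(\<And>x y. f (x + y) = f x + f y) \<Longrightarrow> app (Endo f) = f"
  by (simp add: Endo_inverse)

lemma endo_eqI: "(\<And>x. app f x = app g x) \<Longrightarrow> f = g"
  by (simp add: app_inject[symmetric] fun_eq_iff)

instantiation endo :: (ring_1) ring_1
begin

definition "0 = Endo (\<lambda>x. 0)"
definition "1 = Endo (\<lambda>x. x)"
definition "f + g = Endo (\<lambda>x. app f x + app g x)"
definition "f - g = Endo (\<lambda>x. app f x - app g x)"
definition "- f = Endo (\<lambda>x. - app f x)"
definition "f * g = Endo (\<lambda>x. app f (app g x))"

lemma app_zero [simp]: "app 0 x = 0"
  by (simp add: zero_endo_def app_Endo)

lemma app_one [simp]: "app 1 x = x"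
  by (simp add: one_endo_def app_Endo)

lemma app_plus [simp]: "app (f + g) x = app f x + app g x"
  by (simp add: plus_endo_def app_Endo app_add algebra_simps)

lemma app_minus [simp]: "app (f - g) x = app f x - app g x"
  by (simp add: minus_endo_def app_Endo app_add algebra_simps)

lemma app_uminus [simp]: "app (- f) x = - app f x"
  by (simp add: uminus_endo_def app_Endo app_add algebra_simps)

lemma app_mult [simp]: "app (f * g) x = app f (app g x)"
  by (simp add: times_endo_def app_Endo app_add algebra_simps)

instance
proof
  fix f g h :: "'a endo"
  show "f * g * h = f * (g * h)" "1 * f = f" "f * 1 = f" "f + g + h = f + (g + h)" "f + g = g + f"
    "0 + f = f" "- f + f = 0" "f - g = f + - g" "(f + g) * h = f * h + g * h"
    "f * (g + h) = f * g + f * h"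
    by (auto intro!: endo_eqI simp: algebra_simps app_add)
  have "app (0 :: 'a endo) 1 \<noteq> app 1 1" by (simp only: app_zero app_one) simp
  thus "(0 :: 'a endo) \<noteq> 1" by metis
qed

end

lemma app_0_right [simp]: "app f 0 = 0"
  using app_add[of f 0 0] by simp

lemma app_diff: "app f (x - y) = app f x - app f y"
  using app_add[of f "x - y" y] by (simp add: algebra_simps)

lemma app_of_nat [simp]: "app (of_nat n) x = of_nat n * x"
  by (induction n) (auto simp: algebra_simps)

lemma app_of_nat_mult: "app f (of_nat n * x) = of_nat n * app f x"
  by (induction n) (auto simp: algebra_simps app_add)

lemma app_image_multiples: "app f ` G \<subseteq> G' \<Longrightarrow> app f ` multiples n G \<subseteq> multiples n G'"
  by (auto elim!: multiplesE simp: app_of_nat_mult intro!: multiplesI)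

section \<open>Roots of operators close to the identity\<close>

text \<open>
  The binomial expansion with everything of order two collected in \<open>D * B * B\<close>, where \<open>D\<close> is an
  integral polynomial in \<open>B\<close> and therefore maps every \<open>B\<close>-stable subgroup to itself.
\<close>

lemma endo_power_expansion:
  fixes B :: "'a::ring_1 endo"
  shows "\<exists>D. (1 + B) ^ n = 1 + of_nat n * B + D * B * B \<and>
             (\<forall>G. add_subgroup G \<longrightarrow> app B ` G \<subseteq> G \<longrightarrow> app D ` G \<subseteq> G)"
proof (induction n)
  case 0
  show ?case by (rule exI[of _ 0]) (auto simp: add_subgroup_zero)
next
  case (Suc n)
  then obtain D where D: "(1 + B) ^ n = 1 + of_nat n * B + D * B * B"
    and st: "\<And>G. add_subgroup G \<Longrightarrow> app B ` G \<subseteq> G \<Longrightarrow> app D ` G \<subseteq> G" by blast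
  have "(1 + B) ^ Suc n = (1 + of_nat n * B + D * B * B) * (1 + B)"
    by (simp add: D power_Suc2 del: power_Suc)
  also have "\<dots> = 1 + of_nat (Suc n) * B + (of_nat n + D + D * B) * B * B"
    by (simp add: algebra_simps)
  finally have "(1 + B) ^ Suc n = 1 + of_nat (Suc n) * B + (of_nat n + D + D * B) * B * B" .
  moreover have "app (of_nat n + D + D * B) ` G \<subseteq> G" if G: "add_subgroup G" "app B ` G \<subseteq> G" for G
    using st[OF G] G(2) 
    by (auto intro!: add_subgroup_add[OF G(1)] add_subgroup_of_nat_mult[OF G(1)] simp: image_subset_iff)
  ultimately show ?case by blast
qed

text \<open>
  If \<open>B\<close> is divisible by \<open>q\<^sup>2\<close>, the linear term \<open>qB\<close> of \<open>(1 + B)\<^sup>q - 1\<close> dominates the higher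
  terms. For the non-trivial direction, suppose that \<open>B\<close> maps \<open>S\<close> into \<open>U + q\<^sup>sW\<close>. Then the higher
  terms send \<open>S\<close> into \<open>q\<^sup>2(U + q\<^sup>sW)\<close>, so \<open>qB\<close> sends \<open>S\<close> into \<open>qU + q\<^sup>2(U + q\<^sup>sW)\<close>, and
  cancelling \<open>q\<close> improves \<open>s\<close> to \<open>s + 1\<close>. Since \<open>U\<close> contains a multiple of \<open>W\<close>, finitely many
  improvements suffice. The contraction hypothesis is conditional because, for conjugation
  operators, what \<open>B\<close> does to \<open>U\<close> is known only through what it does to \<open>S\<close>.
\<close>

lemma power_root_subgroup_iff:
  fixes B :: "'a::ring_1 endo" and q :: nat
  assumes torsion_free: "\<forall>x::'a. of_nat q * x = 0 \<longrightarrow> x = 0"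
    and W: "add_subgroup W" and U: "add_subgroup U"
    and SW: "app B ` S \<subseteq> W"
    and WU: "multiples (q ^ r) W \<subseteq> U"
    and contract: "\<And>s. app B ` S \<subseteq> U + multiples (q ^ s) W \<Longrightarrow>
        app B ` (U + multiples (q ^ s) W) \<subseteq> multiples (q ^ 2) (U + multiples (q ^ s) W)"
  shows "app ((1 + B) ^ q - 1) ` S \<subseteq> multiples q U \<longleftrightarrow> app B ` S \<subseteq> U"
proof -
  \<comment> \<open>Induction on \<open>s\<close> will show that \<open>B\<close> maps \<open>S\<close> into \<open>Y s\<close>; and \<open>Y r = U\<close>.\<close>
  define Y where "Y s = U + multiples (q ^ s) W" for s
  have Y: "add_subgroup (Y s)" for s
    by (auto simp: Y_def intro!: add_subgroup_set_plus U add_subgroup_multiples W)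
  have UY: "U \<subseteq> Y s" for s
    using set_plus_intro[of _ U 0] add_subgroup_zero[OF add_subgroup_multiples[OF W]]
    by (force simp: Y_def)
  have Yr: "Y r = U"
    using UY[of r] WU by (auto simp: Y_def elim!: set_plus_elim intro: add_subgroup_add[OF U])
  have q2: "multiples (q ^ 2) (Y s) \<subseteq> multiples q (multiples q (Y s))" for s
    by (simp add: multiples_multiples power2_eq_square)
  have qY: "multiples q (Y s) \<subseteq> Y (Suc s)" for s
    unfolding Y_def multiples_set_plus using multiples_subset[OF U, of q]
    by (simp add: multiples_multiples set_plus_mono2)
  obtain D where D: "(1 + B) ^ q = 1 + of_nat q * B + D * B * B"
    and st: "\<And>G. add_subgroup G \<Longrightarrow> app B ` G \<subseteq> G \<Longrightarrow> app D ` G \<subseteq> G"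
    using endo_power_expansion[of B q] by blast
  have eq: "app ((1 + B) ^ q - 1) x = of_nat q * app B x + app D (app B (app B x))" for x
    by (simp add: D)
  have tail: "app D (app B (app B x)) \<in> multiples q (multiples q (Y s))"
    if s: "app B ` S \<subseteq> Y s" and x: "x \<in> S" for x s
  proof -
    have c: "app B ` Y s \<subseteq> multiples (q ^ 2) (Y s)"
      using contract[of s] s unfolding Y_def by blast
    hence "app B (app B x) \<in> multiples (q ^ 2) (Y s)" using s x by blast
    moreover have "app B ` multiples (q ^ 2) (Y s) \<subseteq> multiples (q ^ 2) (Y s)"
      using c multiples_subset[OF Y, of "q ^ 2"] by (intro app_image_multiples) blast
    ultimately have "app D (app B (app B x)) \<in> multiples (q ^ 2) (Y s)"
      using st[OF add_subgroup_multiples[OF Y]] by blast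
    thus ?thesis using q2 by blast
  qed
  show ?thesis
  proof
    assume *: "app B ` S \<subseteq> U"
    have mq: "add_subgroup (multiples q U)" by (intro add_subgroup_multiples U)
    show "app ((1 + B) ^ q - 1) ` S \<subseteq> multiples q U"
    proof safe
      fix x assume x: "x \<in> S"
      have "app D (app B (app B x)) \<in> multiples q (multiples q U)"
        using tail[of r x] * x by (simp add: Yr)
      hence "app D (app B (app B x)) \<in> multiples q U"
        using multiples_subset[OF mq] by blast
      moreover have "of_nat q * app B x \<in> multiples q U" using * x by (auto intro: multiplesI)
      ultimately show "app ((1 + B) ^ q - 1) x \<in> multiples q U"
        unfolding eq by (intro add_subgroup_add mq)
    qed
  next
    assume *: "app ((1 + B) ^ q - 1) ` S \<subseteq> multiples q U"
    have "app B ` S \<subseteq> Y s" for s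
    proof (induction s)
      case 0
      have "W \<subseteq> Y 0"
        using set_plus_intro[of 0 U _ W] add_subgroup_zero[OF U] by (force simp: Y_def)
      thus ?case using SW by blast
    next
      case (Suc s)
      show ?case
      proof safe
        fix x assume x: "x \<in> S"
        have mq: "add_subgroup (multiples q (Y (Suc s)))" by (intro add_subgroup_multiples Y)
        have "app D (app B (app B x)) \<in> multiples q (Y (Suc s))"
          using tail[OF Suc x] multiples_mono[OF qY[of s], of q] by blast
        moreover have "app ((1 + B) ^ q - 1) x \<in> multiples q (Y (Suc s))"
          using * x multiples_mono[OF UY[of "Suc s"], of q] by blast
        ultimately have "of_nat q * app B x \<in> multiples q (Y (Suc s))"
          using add_subgroup_diff[OF mq] unfolding eq by fastforce
        then obtain y where y: "y \<in> Y (Suc s)" "of_nat q * app B x = of_nat q * y"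
          by (auto elim: multiplesE)
        hence "of_nat q * (app B x - y) = 0" by (simp add: right_diff_distrib)
        thus "app B x \<in> Y (Suc s)" using torsion_free y(1) by fastforce
      qed
    qed
    thus "app B ` S \<subseteq> U" using Yr by blast
  qed
qed

text \<open>
  Applied to \<open>T\<close>, \<open>T ^ q\<close>, \<open>T ^ (q ^ 2)\<close> and so on in turn, the previous lemma compares \<open>T - 1\<close> with the
  difference quotient of \<open>T\<close> at a high power of \<open>q\<close>, that is, with an approximate logarithm of \<open>T\<close>.
\<close>

lemma iterated_power_root_subgroup_iff:
  fixes T :: "'a::ring_1 endo" and q :: nat
  assumes torsion_free: "\<forall>x::'a. of_nat q * x = 0 \<longrightarrow> x = 0"
    and W: "add_subgroup W" and U: "add_subgroup U"
    and SW: "\<And>i. app (T ^ (q ^ i) - 1) ` S \<subseteq> W"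
    and WU: "multiples (q ^ r) W \<subseteq> U"
    and contract: "\<And>i s. app (T ^ (q ^ i) - 1) ` S \<subseteq> multiples (q ^ i) U + multiples (q ^ s) W \<Longrightarrow>
        app (T ^ (q ^ i) - 1) ` (multiples (q ^ i) U + multiples (q ^ s) W) \<subseteq>
        multiples (q ^ 2) (multiples (q ^ i) U + multiples (q ^ s) W)"
  shows "app (T ^ (q ^ k) - 1) ` S \<subseteq> multiples (q ^ k) U \<longleftrightarrow> app (T - 1) ` S \<subseteq> U"
proof (induction k)
  case (Suc k)
  have "app ((1 + (T ^ (q ^ k) - 1)) ^ q - 1) ` S \<subseteq> multiples q (multiples (q ^ k) U) \<longleftrightarrow>
        app (T ^ (q ^ k) - 1) ` S \<subseteq> multiples (q ^ k) U"
  proof (rule power_root_subgroup_iff[OF torsion_free W])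
    show "add_subgroup (multiples (q ^ k) U)" by (intro add_subgroup_multiples U)
    show "multiples (q ^ (k + r)) W \<subseteq> multiples (q ^ k) U"
      using multiples_mono[OF WU, of "q ^ k"] by (simp add: multiples_multiples power_add)
  qed (use SW contract in auto)
  moreover have "(1 + (T ^ (q ^ k) - 1)) ^ q = T ^ (q ^ Suc k)"
    by (simp add: power_mult[symmetric] mult.commute)
  ultimately show ?case using Suc by (simp add: multiples_multiples)
qed simp

text \<open>
  Multiples of \<open>q ^ k\<close> are recognised by the factor \<open>of_nat (q ^ k)\<close>, which must stay in this form.
\<close>

declare of_nat_power [simp del]

section \<open>Counting cosets\<close>

text \<open>
  All finite quotients are counted as images \<open>f ` A\<close>, where \<open>f\<close> is \<open>coset U\<close> after some map:
  equality of values of \<open>f\<close> is then congruence modulo \<open>U\<close>, and no quotient groups have to be formed.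
\<close>

definition coset :: "'a::ab_group_add set \<Rightarrow> 'a \<Rightarrow> 'a set" where
  "coset U x = {y. y - x \<in> U}"

lemma coset_eq_iff:
  assumes "add_subgroup U" shows "coset U x = coset U y \<longleftrightarrow> x - y \<in> U"
proof
  assume "coset U x = coset U y"
  moreover have "x \<in> coset U x" by (simp add: coset_def add_subgroup_zero[OF assms])
  ultimately show "x - y \<in> U" by (simp add: coset_def)
next
  assume xy: "x - y \<in> U"
  have "z - x \<in> U \<longleftrightarrow> z - y \<in> U" for z
    using add_subgroup_add[OF assms _ xy, of "z - x"] add_subgroup_diff[OF assms _ xy, of "z - y"] by auto
  thus "coset U x = coset U y" by (auto simp: coset_def)
qed

text \<open>
  Most bijections between finite quotients below are obtained in this form; the correspondence sends
  \<open>f a\<close> to \<open>g a\<close>.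
\<close>

lemma card_image_eq_card_image:
  assumes "\<And>a b. a \<in> A \<Longrightarrow> b \<in> A \<Longrightarrow> f a = f b \<longleftrightarrow> g a = g b"
  shows "card (f ` A) = card (g ` A)"
proof (rule bij_betw_same_card)
  show "bij_betw (\<lambda>c. g (inv_into A f c)) (f ` A) (g ` A)"
  proof (rule bij_betwI')
    fix c e assume "c \<in> f ` A" "e \<in> f ` A"
    thus "(g (inv_into A f c) = g (inv_into A f e)) = (c = e)"
      using assms by (metis f_inv_into_f inv_into_into)
  next
    fix c assume "c \<in> f ` A"
    thus "g (inv_into A f c) \<in> g ` A" by (simp add: inv_into_into)
  next
    fix y assume "y \<in> g ` A"
    then obtain a where "a \<in> A" "y = g a" by blast
    thus "\<exists>c\<in>f ` A. y = g (inv_into A f c)"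
      using assms by (metis f_inv_into_f image_eqI inv_into_into)
  qed
qed

lemma finite_image_if_factors:
  assumes "finite (g ` A)" "\<And>a b. a \<in> A \<Longrightarrow> b \<in> A \<Longrightarrow> g a = g b \<Longrightarrow> f a = f b"
  shows "finite (f ` A)"
proof -
  have "f ` A = (\<lambda>t. f (inv_into A g t)) ` g ` A"
    unfolding image_image using assms(2) by (intro image_cong refl) (metis f_inv_into_f image_eqI inv_into_into)
  thus ?thesis using assms(1) by simp
qed

lemma card_image_fibers:
  assumes fin: "finite (f ` A)"
    and fg: "\<And>a b. a \<in> A \<Longrightarrow> b \<in> A \<Longrightarrow> f a = f b \<Longrightarrow> g a = g b"
    and c: "\<And>a. a \<in> A \<Longrightarrow> card (f ` {b \<in> A. g b = g a}) = c"
  shows "card (f ` A) = card (g ` A) * c"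
proof -
  have "g ` A = (\<lambda>t. g (inv_into A f t)) ` f ` A"
    unfolding image_image using fg by (intro image_cong refl) (metis f_inv_into_f image_eqI inv_into_into)
  hence fing: "finite (g ` A)" using fin by simp
  have "f ` A = (\<Union>t\<in>g ` A. f ` {b \<in> A. g b = t})" by auto
  also have "card \<dots> = (\<Sum>t\<in>g ` A. card (f ` {b \<in> A. g b = t}))"
  proof (rule card_UN_disjoint)
    show "\<forall>t\<in>g ` A. finite (f ` {b \<in> A. g b = t})"
      by (intro ballI finite_subset[OF _ fin]) auto
    show "\<forall>t\<in>g ` A. \<forall>u\<in>g ` A. t \<noteq> u \<longrightarrow>
       f ` {b \<in> A. g b = t} \<inter> f ` {b \<in> A. g b = u} = {}"
    proof (intro ballI impI equals0I)
      fix t u x assume "t \<noteq> u" "x \<in> f ` {b \<in> A. g b = t} \<inter> f ` {b \<in> A. g b = u}"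
      then obtain a b where "a \<in> A" "b \<in> A" "f a = f b" "g a = t" "g b = u" by auto
      thus False using fg[of a b] \<open>t \<noteq> u\<close> by simp
    qed
  qed (use fing in simp)
  also have "\<dots> = (\<Sum>t\<in>g ` A. c)" using c by (intro sum.cong) auto
  finally show ?thesis by simp
qed

text \<open>
  Lagrange's theorem \<open>|A / K\<^sub>1| = |A / K\<^sub>2| \<cdot> |K\<^sub>2 / K\<^sub>1|\<close> for the kernels \<open>K\<^sub>1 \<subseteq> K\<^sub>2\<close> of the maps
  induced by \<open>\<psi>\<close> and \<open>\<phi>\<close> on \<open>A\<close>: the fibres of the second map are translates of \<open>K\<^sub>2\<close>.
\<close>

lemma card_coset_image_tower:
  fixes \<phi> :: "'a::ab_group_add \<Rightarrow> 'b::ab_group_add" and \<psi> :: "'a \<Rightarrow> 'c::ab_group_add"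
  assumes A: "add_subgroup A" and I: "add_subgroup I" and U: "add_subgroup U"
    and \<phi>: "\<And>a b. \<phi> (a - b) = \<phi> a - \<phi> b" and \<psi>: "\<And>a b. \<psi> (a - b) = \<psi> a - \<psi> b"
    and IU: "\<And>a. a \<in> A \<Longrightarrow> \<psi> a \<in> I \<Longrightarrow> \<phi> a \<in> U"
    and fin: "finite ((\<lambda>a. coset I (\<psi> a)) ` A)"
  shows "card ((\<lambda>a. coset I (\<psi> a)) ` A) =
         card ((\<lambda>a. coset U (\<phi> a)) ` A) * card ((\<lambda>a. coset I (\<psi> a)) ` {a \<in> A. \<phi> a \<in> U})"
proof (rule card_image_fibers[OF fin])
  fix a b assume "a \<in> A" "b \<in> A" "coset I (\<psi> a) = coset I (\<psi> b)"
  thus "coset U (\<phi> a) = coset U (\<phi> b)"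
    using IU[of "a - b"] add_subgroup_diff[OF A] by (simp add: coset_eq_iff I U \<phi> \<psi>)
next
  fix a assume a: "a \<in> A"
  have "{b \<in> A. coset U (\<phi> b) = coset U (\<phi> a)} = (\<lambda>k. k + a) ` {k \<in> A. \<phi> k \<in> U}"
  proof (intro equalityI subsetI)
    fix b assume "b \<in> {b \<in> A. coset U (\<phi> b) = coset U (\<phi> a)}"
    hence "b - a \<in> {k \<in> A. \<phi> k \<in> U}"
      using add_subgroup_diff[OF A _ a] by (simp add: coset_eq_iff U \<phi>)
    thus "b \<in> (\<lambda>k. k + a) ` {k \<in> A. \<phi> k \<in> U}"
      by (intro image_eqI[of _ _ "b - a"]) auto
  next
    fix b assume "b \<in> (\<lambda>k. k + a) ` {k \<in> A. \<phi> k \<in> U}"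
    then obtain k where k: "k \<in> A" "\<phi> k \<in> U" "b = k + a" by blast
    thus "b \<in> {b \<in> A. coset U (\<phi> b) = coset U (\<phi> a)}"
      using add_subgroup_add[OF A k(1) a] \<phi>[of "k + a" a] by (simp add: coset_eq_iff U)
  qed
  hence "card ((\<lambda>b. coset I (\<psi> b)) ` {b \<in> A. coset U (\<phi> b) = coset U (\<phi> a)}) =
        card ((\<lambda>k. coset I (\<psi> (k + a))) ` {k \<in> A. \<phi> k \<in> U})"
    by (simp add: image_image)
  also have "\<dots> = card ((\<lambda>k. coset I (\<psi> k)) ` {k \<in> A. \<phi> k \<in> U})"
    using \<psi>[of "_ + a" "_ + a"] by (intro card_image_eq_card_image) (simp add: coset_eq_iff I flip: \<psi>)
  finally show "card ((\<lambda>b. coset I (\<psi> b)) ` {b \<in> A. coset U (\<phi> b) = coset U (\<phi> a)}) =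
        card ((\<lambda>k. coset I (\<psi> k)) ` {k \<in> A. \<phi> k \<in> U})" .
qed

definition transversal :: "'a::ab_group_add set \<Rightarrow> 'a set \<Rightarrow> 'a set \<Rightarrow> bool" where
  "transversal A U R \<longleftrightarrow> finite R \<and> R \<subseteq> A \<and> inj_on (coset U) R \<and> coset U ` R = coset U ` A"

lemma ex_transversal:
  assumes "finite (coset U ` A)" shows "\<exists>R. transversal A U R"
proof -
  obtain R where R: "R \<subseteq> A" "inj_on (coset U) R" "coset U ` R = coset U ` A"
    by (metis order_refl subset_image_inj)
  moreover have "finite R" using finite_imageD[of "coset U" R] R assms by simp
  ultimately show ?thesis by (auto simp: transversal_def)
qed

lemma card_transversal: "transversal A U R \<Longrightarrow> card R = card (coset U ` A)"
  by (metis card_image transversal_def)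

lemma transversal_obtain:
  assumes "transversal A U R" "add_subgroup U" "x \<in> A"
  obtains r where "r \<in> R" "x - r \<in> U"
  using assms unfolding transversal_def by (metis coset_eq_iff imageE imageI)

lemma transversal_eqI:
  assumes "transversal A U R" "add_subgroup U" "r \<in> R" "s \<in> R" "r - s \<in> U"
  shows "r = s"
  using assms unfolding transversal_def by (metis coset_eq_iff inj_onD)

lemma card_transversal_Collect:
  assumes "transversal A U R" "add_subgroup U" 
    and sat: "\<And>x y. x \<in> A \<Longrightarrow> y \<in> A \<Longrightarrow> x - y \<in> U \<Longrightarrow> Q x \<Longrightarrow> Q y"
  shows "card {x \<in> R. Q x} = card (coset U ` {x \<in> A. Q x})"
proof -
  have R: "R \<subseteq> A" "inj_on (coset U) R" using assms(1) by (auto simp: transversal_def)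
  have "coset U ` {x \<in> A. Q x} = coset U ` {x \<in> R. Q x}"
  proof (intro equalityI subsetI)
    fix t assume "t \<in> coset U ` {x \<in> A. Q x}"
    then obtain x where x: "x \<in> A" "Q x" "t = coset U x" by blast
    obtain r where r: "r \<in> R" "x - r \<in> U" by (rule transversal_obtain[OF assms(1,2) x(1)])
    hence "Q r" using sat[of x r] x R by blast
    thus "t \<in> coset U ` {x \<in> R. Q x}"
      using r x by (intro image_eqI[of _ _ r]) (simp_all add: coset_eq_iff assms(2))
  qed (use R in auto)
  thus ?thesis using inj_on_subset[OF R(2), of "{x \<in> R. Q x}"] by (simp add: card_image)
qed

lemma card_image_le_card_image:
  assumes "finite (f ` A)" "\<And>a b. a \<in> A \<Longrightarrow> b \<in> A \<Longrightarrow> f a = f b \<Longrightarrow> g a = g b"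
  shows "card (g ` A) \<le> card (f ` A)"
proof -
  have "g ` A = (\<lambda>t. g (inv_into A f t)) ` f ` A"
    unfolding image_image using assms(2) by (intro image_cong refl) (metis f_inv_into_f image_eqI inv_into_into)
  thus ?thesis using card_image_le[OF assms(1)] by simp
qed

lemma sum_in_Ints_if_classes:
  fixes f :: "'a \<Rightarrow> rat"
  assumes "finite R" "\<And>x. x \<in> R \<Longrightarrow> sum f {y \<in> R. E x y} \<in> \<int>"
    and refl: "\<And>x. x \<in> R \<Longrightarrow> E x x" and sym: "\<And>x y. x \<in> R \<Longrightarrow> y \<in> R \<Longrightarrow> E x y \<Longrightarrow> E y x"
    and trans: "\<And>x y z. x \<in> R \<Longrightarrow> y \<in> R \<Longrightarrow> z \<in> R \<Longrightarrow> E x y \<Longrightarrow> E y z \<Longrightarrow> E x z"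
  shows "sum f R \<in> \<int>"
proof -
  let ?g = "\<lambda>x. {y \<in> R. E x y}"
  have "sum f R = (\<Sum>c\<in>?g ` R. sum f {x \<in> R. ?g x = c})"
    by (rule sum.image_gen[OF assms(1)])
  also have "\<dots> \<in> \<int>"
  proof (rule Ints_sum)
    fix c assume "c \<in> ?g ` R"
    then obtain x where x: "x \<in> R" "c = ?g x" by blast
    have "{y \<in> R. ?g y = c} = {y \<in> R. E x y}"
    proof (intro equalityI subsetI)
      fix y assume "y \<in> {y \<in> R. ?g y = c}"
      hence "y \<in> R" "y \<in> ?g x" using refl x by auto
      thus "y \<in> {y \<in> R. E x y}" by simp
    next
      fix y assume y: "y \<in> {y \<in> R. E x y}"
      hence "?g y = ?g x" using x sym trans by blast
      thus "y \<in> {y \<in> R. ?g y = c}" using y x by simp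
    qed
    thus "sum f {y \<in> R. ?g y = c} \<in> \<int>" using assms(2)[OF x(1)] by simp
  qed
  finally show ?thesis .
qed

section \<open>The congruence group and its logarithm\<close>

lemma of_nat_power_mult_cancel:
  fixes x y :: "'a::ring_1"
  assumes "\<forall>x::'a. of_nat q * x = 0 \<longrightarrow> x = 0" "of_nat (q ^ k) * x = of_nat (q ^ k) * y"
  shows "x = y"
proof -
  have "of_nat (q ^ k) * z = 0 \<Longrightarrow> z = 0" for z :: 'a
    using assms(1) by (induction k) (auto simp: mult.assoc)
  from this[of "x - y"] assms(2) show ?thesis by (simp add: right_diff_distrib)
qed

text \<open>
  A torsion-free model of the matrices over a valuation ring and their action on the lattice of row
  vectors. Matrices of a fixed size act as zero on all further coordinates, so \<open>1\<close> is not one of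
  them, and \<open>1 + q\<^sup>2M\<close> is formed in the ring of all endomorphisms.
\<close>

locale contracting_pair =
  fixes q :: nat and V :: "'v::ring_1 set" and M :: "'v endo set"
  assumes torsion_free: "\<forall>x::'v. of_nat q * x = 0 \<longrightarrow> x = 0"
    and V: "add_subgroup V" and M: "add_subgroup M"
    and M_mult: "\<And>f g. f \<in> M \<Longrightarrow> g \<in> M \<Longrightarrow> f * g \<in> M"
    and M_V: "\<And>f x. f \<in> M \<Longrightarrow> x \<in> V \<Longrightarrow> app f x \<in> V"
    and finite_V: "\<And>k. finite (coset (multiples (q ^ k) V) ` V)"
    and finite_M: "\<And>k. finite (coset (multiples (q ^ k) M) ` M)"
begin

lemma torsion_free_endo: "\<forall>f :: 'v endo. of_nat q * f = 0 \<longrightarrow> f = 0"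
proof (intro allI impI endo_eqI)
  fix f :: "'v endo" and x assume "of_nat q * f = 0"
  hence "app (of_nat q * f) x = app 0 x" by simp
  thus "app f x = app 0 x" using torsion_free by simp
qed

lemmas cancel_endo = of_nat_power_mult_cancel[OF torsion_free_endo]

definition level :: "nat \<Rightarrow> 'v endo set" where
  "level k = multiples (q ^ k) M"

lemma level_0 [simp]: "level 0 = M"
  by (simp add: level_def)

lemma level_add: "level (k + l) = multiples (q ^ k) (level l)"
  by (simp add: level_def multiples_multiples power_add)

lemma add_subgroup_level: "add_subgroup (level k)"
  unfolding level_def by (intro add_subgroup_multiples M)

lemmas level_diff = add_subgroup_diff[OF add_subgroup_level]
lemmas level_plus = add_subgroup_add[OF add_subgroup_level]
lemmas level_uminus = add_subgroup_uminus[OF add_subgroup_level]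
lemmas level_zero = add_subgroup_zero[OF add_subgroup_level]
lemmas level_of_nat = add_subgroup_of_nat_mult[OF add_subgroup_level]

lemma level_mono: "k \<le> l \<Longrightarrow> f \<in> level l \<Longrightarrow> f \<in> level k"
  unfolding level_def using multiples_power_mono[OF M] by blast

lemma level_M: "f \<in> level k \<Longrightarrow> f \<in> M"
  using level_mono[of 0 k f] by simp

lemma level_scale: "f \<in> level l \<Longrightarrow> of_nat (q ^ k) * f \<in> level (k + l)"
  by (simp add: level_add multiplesI)

lemma level_scale_iff: "of_nat (q ^ k) * f \<in> level (k + l) \<longleftrightarrow> f \<in> level l"
  using level_scale cancel_endo unfolding level_add by (metis multiplesE)

lemma level_mult: 
  assumes "f \<in> level k" "g \<in> level l" shows "f * g \<in> level (k + l)"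
proof -
  obtain f' g' where "f' \<in> M" "g' \<in> M" "f = of_nat (q ^ k) * f'" "g = of_nat (q ^ l) * g'"
    using assms unfolding level_def by (metis multiplesE)
  moreover have "of_nat (q ^ k) * f' * (of_nat (q ^ l) * g') = of_nat (q ^ (k + l)) * (f' * g')"
  proof -
    have "f' * (of_nat (q ^ l) * g') = of_nat (q ^ l) * (f' * g')"
      by (metis mult.assoc mult_of_nat_commute)
    thus ?thesis by (simp add: power_add mult.assoc del: of_nat_power)
  qed
  ultimately show ?thesis unfolding level_def by (metis M_mult multiplesI)
qed

text \<open>
  The principal congruence group \<open>1 + q\<^sup>2M\<close>. The exponent \<open>2\<close> makes second-order
  terms negligible against first-order terms even after the latter have been multiplied by \<open>q\<close>.
\<close>

definition G :: "'v endo set" where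
  "G = {y. y - 1 \<in> level 2}"

lemma G_mult_level_cong:
  assumes "y \<in> G" "f \<in> level k"
  shows "y * f - f \<in> level (k + 2)" "f * y - f \<in> level (k + 2)"
  using level_mult[of "y - 1" 2 f k] level_mult[of f k "y - 1" 2] assms
  by (simp_all add: G_def algebra_simps)

lemma G_mult_level:
  assumes "y \<in> G" "f \<in> level k"
  shows "y * f \<in> level k" "f * y \<in> level k"
  using level_plus[OF level_mono[OF _ G_mult_level_cong(1)[OF assms], of k] assms(2)]
    level_plus[OF level_mono[OF _ G_mult_level_cong(2)[OF assms], of k] assms(2)] by simp_all

lemma G_one: "1 \<in> G"
  by (simp add: G_def level_zero)

lemma G_mult: "y \<in> G \<Longrightarrow> z \<in> G \<Longrightarrow> y * z \<in> G"
  using level_plus[OF G_mult_level(1)[of y "z - 1" 2], of "y - 1"] by (simp add: G_def algebra_simps)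

lemma G_power: "y \<in> G \<Longrightarrow> y ^ n \<in> G"
  by (induction n) (auto intro: G_one G_mult)

lemma G_diff: "y \<in> G \<Longrightarrow> z \<in> G \<Longrightarrow> y - z \<in> level 2"
  using level_diff[of "y - 1" 2 "z - 1"] by (simp add: G_def)

lemma G_app:
  assumes "y \<in> G" "add_subgroup U" "\<And>f u. f \<in> M \<Longrightarrow> u \<in> U \<Longrightarrow> app f u \<in> U" "u \<in> U"
  shows "app y u \<in> U"
  using add_subgroup_add[OF assms(2) assms(3)[OF level_M[of "y - 1" 2] assms(4)] assms(4)] assms(1)
  by (simp add: G_def)

text \<open>
  The differential of \<open>y \<mapsto> y\<^sup>n\<close> is multiplication by \<open>n\<close>, up to two more powers of \<open>q\<close>.
\<close>

lemma power_diff_cong: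
  assumes "y \<in> G" "z \<in> G" "y - z \<in> level t"
  shows "y ^ n - z ^ n - of_nat n * (y - z) \<in> level (t + 2)"
proof (induction n)
  case 0
  show ?case by (simp add: level_zero)
next
  case (Suc n)
  have "y ^ n - z ^ n \<in> level t"
    using level_plus[OF level_mono[OF _ Suc, of t] level_of_nat[OF assms(3), of n]] by simp
  hence "(y - 1) * (y ^ n - z ^ n) \<in> level (t + 2)"
    using level_mult[of "y - 1" 2 _ t] assms(1) by (simp add: G_def add.commute)
  moreover have "(y - z) * (z ^ n - 1) \<in> level (t + 2)"
    using level_mult[OF assms(3), of "z ^ n - 1" 2] G_power[OF assms(2), of n] by (simp add: G_def)
  ultimately have "(y - 1) * (y ^ n - z ^ n) + (y ^ n - z ^ n - of_nat n * (y - z)) + (y - z) * (z ^ n - 1)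
      \<in> level (t + 2)"
    using Suc by (intro level_plus)
  also have "(y - 1) * (y ^ n - z ^ n) + (y ^ n - z ^ n - of_nat n * (y - z)) + (y - z) * (z ^ n - 1) =
     y ^ Suc n - z ^ Suc n - of_nat (Suc n) * (y - z)"
    by (simp add: algebra_simps)
  finally show ?case .
qed

text \<open>
  Raising to the power \<open>q\<close> scales distances by exactly \<open>q\<close>. As long as \<open>y - z\<close> is known to be
  divisible by \<open>q\<^sup>t\<close> only, the error in the linear approximation is divisible by \<open>q\<^sup>t\<^sup>+\<^sup>2\<close>, which is
  enough to gain one power of \<open>q\<close>.
\<close>

lemma power_q_diff_level_iff:
  assumes yz: "y \<in> G" "z \<in> G"
  shows "y ^ q - z ^ q \<in> level (Suc s) \<longleftrightarrow> y - z \<in> level s"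
proof
  assume *: "y - z \<in> level s"
  have "y ^ q - z ^ q - of_nat q * (y - z) \<in> level (Suc s)"
    using power_diff_cong[OF yz *, of q] by (rule level_mono[rotated]) simp
  moreover have "of_nat q * (y - z) \<in> level (Suc s)" using level_scale[OF *, of 1] by simp
  ultimately show "y ^ q - z ^ q \<in> level (Suc s)" using level_plus by fastforce
next
  assume *: "y ^ q - z ^ q \<in> level (Suc s)"
  have "t \<le> s \<Longrightarrow> y - z \<in> level t" for t
  proof (induction t)
    case 0
    show ?case using level_M[OF G_diff[OF yz]] by simp
  next
    case (Suc t)
    hence IH: "y - z \<in> level t" by simp
    have "y ^ q - z ^ q \<in> level (t + 2)" using * Suc.prems by (auto intro: level_mono[rotated])
    from level_diff[OF this power_diff_cong[OF yz IH, of q]]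
    have "of_nat (q ^ 1) * (y - z) \<in> level (1 + Suc t)" by simp
    thus ?case unfolding level_scale_iff .
  qed
  thus "y - z \<in> level s" by simp
qed

lemma power_diff_level_iff:
  assumes "y \<in> G" "z \<in> G"
  shows "y ^ (q ^ k) - z ^ (q ^ k) \<in> level (k + s) \<longleftrightarrow> y - z \<in> level s"
proof (induction k)
  case (Suc k)
  have "y ^ (q ^ Suc k) = (y ^ (q ^ k)) ^ q" "z ^ (q ^ Suc k) = (z ^ (q ^ k)) ^ q"
    by (simp_all add: power_mult[symmetric] mult.commute)
  thus ?case using power_q_diff_level_iff[OF G_power[OF assms(1)] G_power[OF assms(2)]] Suc by simp
qed simp

text \<open>
  The logarithm is the limit of \<open>(y ^ P - 1) / P\<close> as \<open>P = q ^ k\<close> tends to zero \<open>q\<close>-adically. The difference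
  quotient at a finite stage takes its place; it is unique because the endomorphism ring has no \<open>q\<close>-torsion.
\<close>

definition lg :: "nat \<Rightarrow> 'v endo \<Rightarrow> 'v endo" where
  "lg k y = (THE a. y ^ (q ^ k) - 1 = of_nat (q ^ k) * a)"

lemma lg:
  assumes "y \<in> G"
  shows "y ^ (q ^ k) = 1 + of_nat (q ^ k) * lg k y" and "lg k y \<in> level 2"
proof -
  have "y ^ (q ^ k) - 1 \<in> level (k + 2)"
    using power_diff_level_iff[OF assms G_one, of k 2] G_diff[OF assms G_one] by simp
  then obtain a where a: "a \<in> level 2" "y ^ (q ^ k) - 1 = of_nat (q ^ k) * a"
    unfolding level_add by (elim multiplesE)
  hence "lg k y = a" unfolding lg_def using cancel_endo[of k _ a] by (intro the_equality) auto
  thus "y ^ (q ^ k) = 1 + of_nat (q ^ k) * lg k y" "lg k y \<in> level 2"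
    using a by (simp_all add: algebra_simps)
qed

lemma lg_diff_level_iff:
  assumes "y \<in> G" "z \<in> G"
  shows "lg k y - lg k z \<in> level s \<longleftrightarrow> y - z \<in> level s"
proof -
  have "y ^ (q ^ k) - z ^ (q ^ k) = of_nat (q ^ k) * (lg k y - lg k z)"
    by (simp add: lg(1)[OF assms(1)] lg(1)[OF assms(2)] right_diff_distrib del: of_nat_power)
  thus ?thesis using power_diff_level_iff[OF assms, of k s] level_scale_iff by simp
qed

lemma finite_coset_level: "A \<subseteq> M \<Longrightarrow> finite (coset (level k) ` A)"
  unfolding level_def by (intro finite_subset[OF _ finite_M[of k]] image_mono)

text \<open>
  The logarithm is an isometry, hence injective modulo \<open>q\<^sup>s\<close>, and \<open>1 + q\<^sup>2M\<close> and \<open>q\<^sup>2M\<close> have the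
  same finite number of classes modulo \<open>q\<^sup>s\<close>; so it is surjective modulo \<open>q\<^sup>s\<close>.
\<close>

lemma ex_lg_cong:
  assumes "a \<in> level 2"
  shows "\<exists>y\<in>G. lg k y - a \<in> level s"
proof -
  let ?c = "coset (level s)"
  define Y where "Y = (\<lambda>y. ?c (y - 1)) ` G"
  have Y: "Y = ?c ` level 2"
  proof -
    have "x \<in> (\<lambda>y. y - 1) ` G" if "x \<in> level 2" for x
      using that by (intro image_eqI[of _ _ "1 + x"]) (simp_all add: G_def)
    hence "(\<lambda>y. y - 1) ` G = level 2" by (auto simp: G_def)
    thus ?thesis unfolding Y_def by (metis image_image)
  qed
  have finY: "finite Y" unfolding Y using level_M by (intro finite_coset_level) blast
  \<comment> \<open>As a set of classes, \<open>Y\<close> is the domain of the logarithm shifted by \<open>1\<close>, and also its codomain.\<close>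
  have "card ((\<lambda>y. ?c (lg k y)) ` G) = card Y"
    unfolding Y_def
    by (intro card_image_eq_card_image)
       (simp add: coset_eq_iff add_subgroup_level lg_diff_level_iff)
  moreover have "(\<lambda>y. ?c (lg k y)) ` G \<subseteq> Y" using lg(2) by (auto simp: Y)
  ultimately have "(\<lambda>y. ?c (lg k y)) ` G = Y" using card_subset_eq[OF finY] by blast
  hence "?c a \<in> (\<lambda>y. ?c (lg k y)) ` G" using assms Y by blast
  then obtain y where "y \<in> G" "?c (lg k y) = ?c a" by force
  thus ?thesis by (auto simp: coset_eq_iff add_subgroup_level)
qed

lemma card_coset_lg:
  assumes S: "S \<subseteq> level 2" and sat: "\<And>a b. a \<in> S \<Longrightarrow> b \<in> level 2 \<Longrightarrow> b - a \<in> level s \<Longrightarrow> b \<in> S"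
  shows "card (coset (level s) ` {y \<in> G. lg k y \<in> S}) = card (coset (level s) ` S)"
proof -
  let ?c = "coset (level s)" and ?Y = "{y \<in> G. lg k y \<in> S}"
  have "card (?c ` ?Y) = card ((\<lambda>y. ?c (lg k y)) ` ?Y)"
    by (intro card_image_eq_card_image) (simp add: coset_eq_iff add_subgroup_level lg_diff_level_iff)
  also have "(\<lambda>y. ?c (lg k y)) ` ?Y = ?c ` S"
  proof (intro equalityI subsetI)
    fix t assume "t \<in> ?c ` S"
    then obtain a where a: "a \<in> S" "t = ?c a" by blast
    then obtain y where y: "y \<in> G" "lg k y - a \<in> level s" using ex_lg_cong S by blast
    hence "lg k y \<in> S" using sat a(1) lg(2) by blast
    thus "t \<in> (\<lambda>y. ?c (lg k y)) ` ?Y" 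
      using a y by (intro image_eqI[of _ _ y]) (simp_all add: coset_eq_iff[symmetric] add_subgroup_level)
  qed auto
  finally show ?thesis .
qed

end

context contracting_pair
begin

lemma q_pos: "q > 0"
  using torsion_free[rule_format, of 1] by (cases q) auto

lemma level_app: "f \<in> level k \<Longrightarrow> x \<in> V \<Longrightarrow> app f x \<in> multiples (q ^ k) V"
  unfolding level_def by (auto elim!: multiplesE intro!: multiplesI M_V)

lemma power_q_in_level: "y \<in> G \<Longrightarrow> y ^ (q ^ k) - 1 \<in> level (k + 2)"
  using power_diff_level_iff[of y 1 k 2] G_one G_diff[of y 1] by simp

end

section \<open>The normaliser of a Lie lattice\<close>

text \<open>
  Here \<open>U\<close> is the sublattice modulo which vectors are considered. The bracket condition on \<open>h\<close> is the
  one that holds for \<open>h = q\<^sup>2\<g>\<close> with a Lie algebra \<open>\<g>\<close>.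
\<close>

locale lie_lattice = contracting_pair q V M for q :: nat and V :: "'v::ring_1 set" and M +
  fixes U :: "'v set" and n :: nat and h :: "'v endo set"
  assumes U: "add_subgroup U" and UV: "U \<subseteq> V"
    and M_U: "\<And>f u. f \<in> M \<Longrightarrow> u \<in> U \<Longrightarrow> app f u \<in> U"
    and VU: "multiples (q ^ n) V \<subseteq> U"
    and h: "add_subgroup h" and h_level: "h \<subseteq> level 2"
    and h_bracket: "\<And>a b. a \<in> h \<Longrightarrow> b \<in> h \<Longrightarrow> a * b - b * a \<in> multiples (q ^ 2) h"
begin

text \<open>
  Adding \<open>q\<^sup>nM\<close> does not change \<open>hx\<close> modulo \<open>U\<close>, and it makes \<open>H\<close> contain a multiple of \<open>M\<close>, as
  the root lemma requires. Group elements matter only modulo \<open>q\<^sup>K\<close>, and \<open>K = n + 2\<close> is chosen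
  such that \<open>q\<^sup>KM\<close> is contained in \<open>q\<^sup>2H\<close>.
\<close>

definition "H = h + level n"

definition "K = n + 2"

text \<open>
  The condition says \<open>y\<^sup>-\<^sup>1by - b \<in> q\<^sup>2H\<close>, written without the inverse of \<open>y\<close> and weakened by the
  harmless error \<open>q\<^sup>KM\<close>. In this form it is immediate that \<open>N\<close> is closed under products.
\<close>

definition N :: "'v endo set" where
  "N = {y \<in> G. \<forall>b\<in>H. \<exists>c\<in>H. b * y - y * (b + of_nat (q ^ 2) * c) \<in> level K}"

text \<open>
  The Lie algebra of \<open>N\<close>, obtained by linearising the defining condition of \<open>N\<close> at \<open>y = 1\<close>.
\<close>

definition norm_alg :: "'v endo set" where
  "norm_alg = {a \<in> level 2. \<forall>b\<in>H. a * b - b * a \<in> multiples (q ^ 2) H}"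

text \<open>
  Since \<open>y ^ (q ^ K)\<close> is \<open>1\<close> modulo \<open>q\<^sup>KM\<close>, this power of \<open>y\<close> is an inverse modulo \<open>q\<^sup>KM\<close>;
  being a power, it lies in every monoid that contains \<open>y\<close>.
\<close>

definition quasi_inv :: "'v endo \<Rightarrow> 'v endo" where
  "quasi_inv y = y ^ (q ^ K - 1)"

lemma H: "add_subgroup H"
  unfolding H_def by (intro add_subgroup_set_plus h add_subgroup_level)

lemma H2: "add_subgroup (multiples (q ^ 2) H)"
  by (intro add_subgroup_multiples H)

lemma level_n_H: "level n \<subseteq> H"
  using set_plus_intro[of 0 h _ "level n"] add_subgroup_zero[OF h] by (force simp: H_def)

lemma h_H: "h \<subseteq> H"
  using set_plus_intro[of _ h 0 "level n"] level_zero by (force simp: H_def)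

lemma H_M: "H \<subseteq> M"
  unfolding H_def using h_level level_M by (auto elim!: set_plus_elim intro: add_subgroup_add[OF M])

lemma H2_H: "multiples (q ^ 2) H \<subseteq> H"
  by (intro multiples_subset H)

lemma level_K_H2: "level K \<subseteq> multiples (q ^ 2) H"
proof -
  have "level K = multiples (q ^ 2) (level n)"
    by (simp add: level_add[symmetric] K_def)
  thus ?thesis using multiples_mono[OF level_n_H] by simp
qed

lemma M_mult_level_K:
  assumes "f \<in> M" "g \<in> level K" shows "f * g \<in> level K" "g * f \<in> level K"
  using level_mult[of f 0 g K] level_mult[of g K f 0] assms by simp_all

lemma level_K_app: "f \<in> level K \<Longrightarrow> x \<in> V \<Longrightarrow> app f x \<in> U"
  using level_app[of f K x] VU multiples_power_mono[OF V, of n K q] by (auto simp: K_def)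

lemma level_n_app: "f \<in> level n \<Longrightarrow> x \<in> V \<Longrightarrow> app f x \<in> U"
  using level_app[of f n x] VU by blast

lemma quasi_inv_G: "y \<in> G \<Longrightarrow> quasi_inv y \<in> G"
  unfolding quasi_inv_def by (rule G_power)

lemma quasi_inv_mult: "y * quasi_inv y = y ^ (q ^ K)" "quasi_inv y * y = y ^ (q ^ K)"
proof -
  have "q ^ K = Suc (q ^ K - 1)" using q_pos by simp
  thus "y * quasi_inv y = y ^ (q ^ K)" "quasi_inv y * y = y ^ (q ^ K)"
    unfolding quasi_inv_def by (metis power_Suc) (metis power_Suc2 \<open>q ^ K = Suc (q ^ K - 1)\<close>)
qed

lemma quasi_inv_level:
  assumes "y \<in> G"
  shows "y * quasi_inv y - 1 \<in> level K" "quasi_inv y * y - 1 \<in> level K"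
  using level_mono[OF _ power_q_in_level[OF assms, of K], of K] by (simp_all add: quasi_inv_mult)

lemma h_norm_alg: "h \<subseteq> norm_alg"
proof
  fix a assume a: "a \<in> h"
  have "a * b - b * a \<in> multiples (q ^ 2) H" if bH: "b \<in> H" for b
  proof -
    obtain b' m where b: "b' \<in> h" "m \<in> level n" "b = b' + m"
      using bH unfolding H_def by (blast elim: set_plus_elim)
    have "a * b' - b' * a \<in> multiples (q ^ 2) H"
      using h_bracket[OF a b(1)] multiples_mono[OF h_H] by blast
    moreover have "a * m - m * a \<in> level K"
      using level_mult[of a 2 m n] level_mult[of m n a 2] a b h_level
      by (auto simp: K_def add.commute intro!: level_diff)
    ultimately have "(a * b' - b' * a) + (a * m - m * a) \<in> multiples (q ^ 2) H"
      using level_K_H2 by (intro add_subgroup_add[OF H2]) auto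
    thus ?thesis by (simp add: b(3) algebra_simps)
  qed
  thus "a \<in> norm_alg" using a h_level by (auto simp: norm_alg_def)
qed

lemma N_iff_conjugation:
  assumes y: "y \<in> G"
  shows "y \<in> N \<longleftrightarrow> (\<forall>b\<in>H. quasi_inv y * b * y - b \<in> multiples (q ^ 2) H)"
proof -
  let ?z = "quasi_inv y"
  have "(\<exists>c\<in>H. b * y - y * (b + of_nat (q ^ 2) * c) \<in> level K) \<longleftrightarrow>
        ?z * b * y - b \<in> multiples (q ^ 2) H" if b: "b \<in> H" for b
  proof
    assume "\<exists>c\<in>H. b * y - y * (b + of_nat (q ^ 2) * c) \<in> level K"
    then obtain c where c: "c \<in> H" "b * y - y * (b + of_nat (q ^ 2) * c) \<in> level K" by blast
    let ?e = "b * y - y * (b + of_nat (q ^ 2) * c)" and ?b = "b + of_nat (q ^ 2) * c"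
    have qc: "of_nat (q ^ 2) * c \<in> multiples (q ^ 2) H" using c by (intro multiplesI)
    have "?b \<in> M" using add_subgroup_add[OF H b, of "of_nat (q ^ 2) * c"] qc H2_H H_M by blast
    hence "(?z * y - 1) * ?b \<in> level K" using M_mult_level_K(2) quasi_inv_level[OF y] by blast
    moreover have "?z * ?e \<in> level K" using G_mult_level(1)[OF quasi_inv_G[OF y] c(2)] .
    ultimately have "?z * ?e + (?z * y - 1) * ?b + of_nat (q ^ 2) * c \<in> multiples (q ^ 2) H"
      using level_K_H2 qc by (intro add_subgroup_add[OF H2]) auto
    also have "?z * ?e + (?z * y - 1) * ?b + of_nat (q ^ 2) * c = ?z * b * y - b"
      by (simp add: algebra_simps)
    finally show "?z * b * y - b \<in> multiples (q ^ 2) H" .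
  next
    assume "?z * b * y - b \<in> multiples (q ^ 2) H"
    then obtain c where c: "c \<in> H" "?z * b * y - b = of_nat (q ^ 2) * c" by (elim multiplesE)
    hence "y * (b + of_nat (q ^ 2) * c) = y * (?z * b * y)" by (metis add_diff_cancel_left' diff_add_cancel add.commute)
    hence "b * y - y * (b + of_nat (q ^ 2) * c) = - ((y * ?z - 1) * b * y)"
      by (simp add: algebra_simps)
    also have "\<dots> \<in> level K"
      using quasi_inv_level[OF y] b H_M y
      by (intro level_uminus G_mult_level M_mult_level_K) auto
    finally show "\<exists>c\<in>H. b * y - y * (b + of_nat (q ^ 2) * c) \<in> level K" using c(1) by blast
  qed
  thus ?thesis using y by (simp add: N_def)
qed

text \<open>
  Conjugation \<open>T: b \<mapsto> y\<^sup>-\<^sup>1by\<close> is close to the identity on \<open>M\<close>, and by the root lemma \<open>T - 1\<close> maps \<open>H\<close>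
  into \<open>q\<^sup>2H\<close> if and only if \<open>T\<^sup>P - 1\<close> maps \<open>H\<close> into \<open>Pq\<^sup>2H\<close>, where \<open>P = q ^ K\<close>. But \<open>T\<^sup>P\<close> is
  conjugation by \<open>y\<^sup>P = 1 + Pa\<close> with \<open>a = lg K y\<close>, and \<open>b(1 + Pa) - (1 + Pa)b = P[b, a]\<close>; so the
  second condition is the defining condition of \<open>norm_alg\<close>.
\<close>

lemma N_iff_lg:
  assumes y: "y \<in> G"
  shows "y \<in> N \<longleftrightarrow> lg K y \<in> norm_alg"
proof -
  define z where "z = quasi_inv y"
  have z: "z \<in> G" using quasi_inv_G[OF y] by (simp add: z_def)
  define T :: "'v endo endo" where "T = Endo (\<lambda>b. z * b * y)"
  have T: "app T b = z * b * y" for b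
    unfolding T_def by (subst app_Endo) (simp_all add: algebra_simps)
  have Tpow: "app (T ^ i) b = z ^ i * b * y ^ i" for i b
    by (induction i) (simp_all add: T mult.assoc power_commutes)
  have small: "app (T ^ (q ^ i) - 1) f \<in> level (k + i + 2)" if f: "f \<in> level k" for f k i
  proof -
    let ?y = "y ^ (q ^ i)" and ?z = "z ^ (q ^ i)"
    have "?z * f * ?y - f = (?z - 1) * (f * ?y) + f * (?y - 1)" by (simp add: algebra_simps)
    also have "\<dots> \<in> level (k + i + 2)"
      using level_mult[OF power_q_in_level[OF z, of i] G_mult_level(2)[OF G_power[OF y] f, of "q ^ i"]]
        level_mult[OF f power_q_in_level[OF y, of i]] by (intro level_plus) (simp_all add: ac_simps)
    finally show ?thesis by (simp add: Tpow)
  qed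
  have iter: "app (T ^ (q ^ K) - 1) ` H \<subseteq> multiples (q ^ K) (multiples (q ^ 2) H) \<longleftrightarrow>
        app (T - 1) ` H \<subseteq> multiples (q ^ 2) H"
  proof (rule iterated_power_root_subgroup_iff[OF torsion_free_endo M H2])
    show "app (T ^ (q ^ i) - 1) ` H \<subseteq> M" for i
      using small[of _ 0 i] level_M H_M by auto
    show "multiples (q ^ K) M \<subseteq> multiples (q ^ 2) H"
      using level_K_H2 by (simp add: level_def)
  next
    fix i s
    let ?B = "T ^ (q ^ i) - 1" and ?U = "multiples (q ^ i) (multiples (q ^ 2) H)"
    let ?Y = "?U + multiples (q ^ s) M"
    assume *: "app ?B ` H \<subseteq> ?Y"
    have Y: "add_subgroup ?Y" by (intro add_subgroup_set_plus add_subgroup_multiples M H)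
    have qY: "add_subgroup (multiples (q ^ 2) ?Y)" by (intro add_subgroup_multiples Y)
    have "app ?B ` ?U \<subseteq> multiples (q ^ i) (multiples (q ^ 2) ?Y)"
      using * by (intro app_image_multiples)
    also have "\<dots> \<subseteq> multiples (q ^ 2) ?Y" by (intro multiples_subset qY)
    finally have BU: "app ?B ` ?U \<subseteq> multiples (q ^ 2) ?Y" .
    have "level s \<subseteq> ?Y"
      using set_plus_intro[of 0 ?U _ "level s"] add_subgroup_zero[of ?U]
      by (force simp: level_def intro: add_subgroup_multiples H)
    hence "level (2 + s) \<subseteq> multiples (q ^ 2) ?Y" unfolding level_add by (rule multiples_mono)
    moreover have "app ?B ` multiples (q ^ s) M \<subseteq> level (2 + s)"
      using small[of _ s i] level_mono[of "2 + s" "s + i + 2"] unfolding level_def[symmetric] by auto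
    ultimately have "app ?B ` multiples (q ^ s) M \<subseteq> multiples (q ^ 2) ?Y" by blast
    with BU show "app ?B ` ?Y \<subseteq> multiples (q ^ 2) ?Y"
      by (auto elim!: set_plus_elim simp: app_add image_subset_iff simp del: app_minus intro!: add_subgroup_add[OF qY])
  qed
  define a where "a = lg K y"
  have yK: "y ^ (q ^ K) = 1 + of_nat (q ^ K) * a" and a: "a \<in> level 2"
    using lg[OF y, of K] by (simp_all add: a_def)
  have "app (T ^ (q ^ K) - 1) b \<in> multiples (q ^ K) (multiples (q ^ 2) H) \<longleftrightarrow>
        a * b - b * a \<in> multiples (q ^ 2) H" if b: "b \<in> H" for b
  proof -
    let ?P = "of_nat (q ^ K) :: 'v endo" and ?z = "z ^ (q ^ K)"
    have bM: "b \<in> M" using b H_M by blast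
    \<comment> \<open>Both factors are powers of \<open>y\<close>, so their product is known to agree with \<open>1\<close> to high order.\<close>
    have "(q ^ K - 1) * q ^ K + q ^ K = q ^ (K + K)"
      using q_pos by (simp add: diff_mult_distrib power_add)
    hence "?z * y ^ (q ^ K) = y ^ (q ^ (K + K))"
      by (simp only: z_def quasi_inv_def power_mult[symmetric] power_add[symmetric])
    hence "(?z * y ^ (q ^ K) - 1) * b \<in> level (K + K)"
      using level_mult[OF power_q_in_level[OF y, of "K + K"], of b 0] bM level_mono[of "K + K" "K + K + 2"]
      by simp
    then obtain e where e: "e \<in> level K" "(?z * y ^ (q ^ K) - 1) * b = ?P * e"
      unfolding level_add by (elim multiplesE)
    define c where "c = (?z - 1) * (b * a - a * b)"
    have "b * a - a * b \<in> M" using bM level_M[OF a] by (intro add_subgroup_diff[OF M] M_mult)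
    hence "c \<in> level K"
      unfolding c_def using M_mult_level_K(2) level_mono[OF _ power_q_in_level[OF z, of K], of K] by simp
    hence ce: "c + e \<in> multiples (q ^ 2) H" using e level_K_H2 level_plus by blast
    have "app (T ^ (q ^ K) - 1) b = ?z * (b * y ^ (q ^ K) - y ^ (q ^ K) * b) + (?z * y ^ (q ^ K) - 1) * b"
      by (simp add: Tpow algebra_simps)
    also have "b * y ^ (q ^ K) - y ^ (q ^ K) * b = ?P * (b * a - a * b)"
      unfolding yK by (simp add: algebra_simps) (metis mult.assoc mult_of_nat_commute)
    also have "?z * (?P * (b * a - a * b)) = ?P * (?z * (b * a - a * b))"
      by (metis mult.assoc mult_of_nat_commute)
    also have "\<dots> + (?z * y ^ (q ^ K) - 1) * b = ?P * ((c + e) - (a * b - b * a))"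
      unfolding e(2) c_def by (simp add: algebra_simps)
    finally have "app (T ^ (q ^ K) - 1) b \<in> multiples (q ^ K) (multiples (q ^ 2) H) \<longleftrightarrow>
        (c + e) - (a * b - b * a) \<in> multiples (q ^ 2) H"
      using cancel_endo by (metis multiplesE multiplesI)
    also have "\<dots> \<longleftrightarrow> a * b - b * a \<in> multiples (q ^ 2) H"
      using add_subgroup_diff[OF H2 ce, of "a * b - b * a"]
        add_subgroup_diff[OF H2 ce, of "(c + e) - (a * b - b * a)"] by auto
    finally show ?thesis .
  qed
  hence "app (T ^ (q ^ K) - 1) ` H \<subseteq> multiples (q ^ K) (multiples (q ^ 2) H) \<longleftrightarrow> a \<in> norm_alg"
    using a by (auto simp: norm_alg_def)
  moreover have "app (T - 1) ` H \<subseteq> multiples (q ^ 2) H \<longleftrightarrow> y \<in> N"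
    unfolding N_iff_conjugation[OF y] by (auto simp: T z_def)
  ultimately show ?thesis using iter by (simp add: a_def)
qed

text \<open>
  The root lemma for \<open>y\<close> as an operator on \<open>V\<close> and the single vector \<open>x\<close>.
\<close>

lemma fixes_iff_lg_annihilates:
  assumes y: "y \<in> G" and x: "x \<in> V"
  shows "app y x - x \<in> U \<longleftrightarrow> app (lg K y) x \<in> U"
proof -
  have "app (y ^ (q ^ K) - 1) ` {x} \<subseteq> multiples (q ^ K) U \<longleftrightarrow> app (y - 1) ` {x} \<subseteq> U"
  proof (rule iterated_power_root_subgroup_iff[OF torsion_free V U])
    show "app (y ^ (q ^ i) - 1) ` {x} \<subseteq> V" for i
      using M_V[OF level_M[OF power_q_in_level[OF y, of i]] x] by simp
    show "multiples (q ^ n) V \<subseteq> U" by (rule VU)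
  next
    fix i s
    let ?Y = "multiples (q ^ i) U + multiples (q ^ s) V"
    have "y ^ (q ^ i) - 1 \<in> level 2"
      using level_mono[OF _ power_q_in_level[OF y, of i], of 2] by simp
    then obtain f where f: "f \<in> M" "y ^ (q ^ i) - 1 = of_nat (q ^ 2) * f"
      unfolding level_def by (elim multiplesE)
    have fY: "app f w \<in> ?Y" if "w \<in> ?Y" for w
      using that f(1) by (auto elim!: set_plus_elim multiplesE simp: app_add app_of_nat_mult
            intro!: set_plus_intro multiplesI M_U M_V)
    show "app (y ^ (q ^ i) - 1) ` ?Y \<subseteq> multiples (q ^ 2) ?Y"
      unfolding f(2) using fY by (auto intro!: multiplesI)
  qed
  also have "y ^ (q ^ K) - 1 = of_nat (q ^ K) * lg K y" using lg(1)[OF y, of K] by simp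
  finally have "of_nat (q ^ K) * app (lg K y) x \<in> multiples (q ^ K) U \<longleftrightarrow> app y x - x \<in> U" by simp
  moreover have "of_nat (q ^ K) * app (lg K y) x \<in> multiples (q ^ K) U \<longleftrightarrow> app (lg K y) x \<in> U"
    using of_nat_power_mult_cancel[OF torsion_free] by (metis multiplesE multiplesI)
  ultimately show ?thesis by simp
qed

end

section \<open>Orbits of the normaliser\<close>

context lie_lattice
begin

lemma N_G: "N \<subseteq> G"
  by (auto simp: N_def)

lemma N_one: "1 \<in> N"
  unfolding N_def using G_one add_subgroup_zero[OF H] level_zero by (auto intro!: bexI[of _ 0])

lemma N_mult:
  assumes "y \<in> N" "y' \<in> N" shows "y * y' \<in> N"
proof -
  have yG: "y \<in> G" "y' \<in> G" using assms N_G by auto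
  have N: "\<exists>c\<in>H. b * y - y * (b + of_nat (q ^ 2) * c) \<in> level K" if "y \<in> N" "b \<in> H" for y b
    using that by (simp add: N_def)
  have "\<exists>c\<in>H. b * (y * y') - y * y' * (b + of_nat (q ^ 2) * c) \<in> level K" if b: "b \<in> H" for b
  proof -
    obtain c where c: "c \<in> H" "b * y - y * (b + of_nat (q ^ 2) * c) \<in> level K"
      using N[OF assms(1) b] by blast
    let ?b = "b + of_nat (q ^ 2) * c"
    have "?b \<in> H" using b c by (intro add_subgroup_add[OF H] add_subgroup_of_nat_mult[OF H])
    then obtain e where e: "e \<in> H" "?b * y' - y' * (?b + of_nat (q ^ 2) * e) \<in> level K"
      using N[OF assms(2)] by blast
    have "(b * y - y * ?b) * y' + y * (?b * y' - y' * (?b + of_nat (q ^ 2) * e)) \<in> level K"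
      using G_mult_level(2)[OF yG(2) c(2)] G_mult_level(1)[OF yG(1) e(2)] by (rule level_plus)
    also have "(b * y - y * ?b) * y' + y * (?b * y' - y' * (?b + of_nat (q ^ 2) * e)) =
        b * (y * y') - y * y' * (b + of_nat (q ^ 2) * (c + e))"
      by (simp add: algebra_simps)
    finally show ?thesis using add_subgroup_add[OF H c(1) e(1)] by blast
  qed
  thus ?thesis using G_mult[OF yG] by (simp add: N_def)
qed

lemma N_quasi_inv: "y \<in> N \<Longrightarrow> quasi_inv y \<in> N"
proof -
  assume "y \<in> N"
  hence "y ^ i \<in> N" for i by (induction i) (auto intro: N_one N_mult)
  thus ?thesis by (simp add: quasi_inv_def)
qed

lemma G_U: "y \<in> G \<Longrightarrow> u \<in> U \<Longrightarrow> app y u \<in> U"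
  using G_app[OF _ U M_U] by blast

lemma G_V: "y \<in> G \<Longrightarrow> u \<in> V \<Longrightarrow> app y u \<in> V"
  using G_app[OF _ V M_V] by blast

lemma quasi_inv_app:
  assumes "y \<in> G" "x \<in> V"
  shows "app (quasi_inv y) (app y x) - x \<in> U"
  using level_K_app[OF quasi_inv_level(2)[OF assms(1)] assms(2)] by simp

lemma norm_alg_subgroup: "add_subgroup norm_alg"
proof (rule add_subgroupI)
  show "0 \<in> norm_alg" by (simp add: norm_alg_def level_zero add_subgroup_zero[OF H2])
  fix a a' assume "a \<in> norm_alg" "a' \<in> norm_alg"
  moreover have "(a - a') * b - b * (a - a') = (a * b - b * a) - (a' * b - b * a')" for b
    by (simp add: algebra_simps)
  ultimately show "a - a' \<in> norm_alg"
    by (auto simp: norm_alg_def intro: level_diff add_subgroup_diff[OF H2])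
qed

lemma level_K_norm_alg: "level K \<subseteq> norm_alg"
proof
  fix a assume a: "a \<in> level K"
  have "a * b - b * a \<in> multiples (q ^ 2) H" if "b \<in> H" for b
    using level_diff[OF M_mult_level_K(2)[OF _ a] M_mult_level_K(1)[OF _ a]] that H_M level_K_H2 by blast
  thus "a \<in> norm_alg" using level_mono[OF _ a, of 2] by (simp add: norm_alg_def K_def)
qed

lemma norm_alg_M: "norm_alg \<subseteq> M"
  unfolding norm_alg_def using level_M by blast

text \<open>
  By the orbit-stabiliser theorem the orbit has \<open>|N| / |St|\<close> elements and by Lagrange's theorem
  \<open>\<n>x\<close> has \<open>|\<n>| / |An|\<close> elements, all counted modulo \<open>q\<^sup>K\<close>. The logarithm matches \<open>N\<close> with \<open>\<n>\<close> and
  the stabiliser \<open>St\<close> with the annihilator \<open>An\<close>.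
\<close>

lemma card_orbit_eq_card_tangent:
  assumes x: "x \<in> V"
  shows "card ((\<lambda>y. coset U (app y x)) ` N) = card ((\<lambda>a. coset U (app a x)) ` norm_alg)"
proof -
  let ?c = "coset (level K)"
  let ?St = "{y \<in> N. app y x - x \<in> U}" and ?An = "{a \<in> norm_alg. app a x \<in> U}"
  note cK = coset_eq_iff[OF add_subgroup_level] and cU = coset_eq_iff[OF U]
  have "card (?c ` {y \<in> G. lg K y \<in> norm_alg}) = card (?c ` norm_alg)"
  proof (rule card_coset_lg)
    show "norm_alg \<subseteq> level 2" by (auto simp: norm_alg_def)
    fix a b assume "a \<in> norm_alg" "b - a \<in> level K"
    hence "(b - a) + a \<in> norm_alg"
      using level_K_norm_alg by (intro add_subgroup_add[OF norm_alg_subgroup]) auto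
    thus "b \<in> norm_alg" by simp
  qed
  moreover have "{y \<in> G. lg K y \<in> norm_alg} = N" using N_iff_lg N_G by blast
  ultimately have card_N: "card (?c ` N) = card (?c ` norm_alg)" by simp
  have "card (?c ` {y \<in> G. lg K y \<in> ?An}) = card (?c ` ?An)"
  proof (rule card_coset_lg)
    show "?An \<subseteq> level 2" by (auto simp: norm_alg_def)
    fix a b assume ab: "a \<in> ?An" "b - a \<in> level K"
    hence "(b - a) + a \<in> norm_alg"
      using level_K_norm_alg by (intro add_subgroup_add[OF norm_alg_subgroup]) auto
    moreover have "app (b - a) x + app a x \<in> U"
      using ab level_K_app[OF ab(2) x] by (intro add_subgroup_add[OF U]) auto
    ultimately show "b \<in> ?An" by simp
  qed
  moreover have "{y \<in> G. lg K y \<in> ?An} = ?St"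
    using N_iff_lg N_G fixes_iff_lg_annihilates[OF _ x] by blast
  ultimately have card_St: "card (?c ` ?St) = card (?c ` ?An)" by simp
  have NM: "(\<lambda>y. y - 1) ` N \<subseteq> M"
    using N_G level_M by (auto simp: G_def)
  have finN: "finite (?c ` N)"
  proof (rule finite_image_if_factors)
    show "finite ((\<lambda>y. ?c (y - 1)) ` N)"
      using finite_coset_level[OF NM, of K] by (simp add: image_image)
  qed (simp add: cK)
  have eq_N: "card (?c ` N) = card ((\<lambda>y. coset U (app y x)) ` N) * card (?c ` ?St)"
  proof (rule card_image_fibers[OF finN])
    fix a b assume "?c a = ?c b"
    thus "coset U (app a x) = coset U (app b x)" using level_K_app[OF _ x, of "a - b"] by (simp add: cK cU)
  next
    fix y assume y: "y \<in> N"
    define z where "z = quasi_inv y"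
    have zN: "z \<in> N" and zG: "z \<in> G" and yG: "y \<in> G"
      using N_quasi_inv[OF y] y N_G by (auto simp: z_def)
    \<comment> \<open>Modulo \<open>q\<^sup>K\<close>, the group elements that move \<open>x\<close> to \<open>yx\<close> form the coset of the stabiliser through \<open>y\<close>.\<close>
    have "?c ` {b \<in> N. coset U (app b x) = coset U (app y x)} = (\<lambda>s. ?c (y * s)) ` ?St"
    proof (intro equalityI subsetI)
      fix t assume "t \<in> ?c ` {b \<in> N. coset U (app b x) = coset U (app y x)}"
      then obtain b where b: "b \<in> N" "app b x - app y x \<in> U" "t = ?c b" by (auto simp: cU)
      have "app z (app b x - app y x) + (app z (app y x) - x) \<in> U"
        unfolding z_def using quasi_inv_app[OF yG x] G_U[OF quasi_inv_G[OF yG] b(2)]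
        by (intro add_subgroup_add[OF U])
      hence "z * b \<in> ?St" using N_mult[OF zN b(1)] by (simp add: app_diff)
      moreover have "(y * z - 1) * b \<in> level K"
        using G_mult_level(2)[of b "y * z - 1" K] quasi_inv_level(1)[OF yG] b N_G by (auto simp: z_def)
      hence "?c b = ?c (y * (z * b))"
        using level_uminus[of "(y * z - 1) * b" K] by (simp add: cK algebra_simps)
      ultimately show "t \<in> (\<lambda>s. ?c (y * s)) ` ?St" using b(3) by blast
    next
      fix t assume "t \<in> (\<lambda>s. ?c (y * s)) ` ?St"
      then obtain s where s: "s \<in> N" "app s x - x \<in> U" "t = ?c (y * s)" by blast
      have "app (y * s) x - app y x \<in> U" using G_U[OF yG s(2)] by (simp add: app_diff)
      thus "t \<in> ?c ` {b \<in> N. coset U (app b x) = coset U (app y x)}"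
        using N_mult[OF y s(1)] s(3) by (auto simp: cU)
    qed
    also have "card \<dots> = card (?c ` ?St)"
    proof (rule card_image_eq_card_image)
      fix s s' assume s: "s \<in> ?St" "s' \<in> ?St"
      show "(?c (y * s) = ?c (y * s')) = (?c s = ?c s')"
      proof -
        have "s - s' \<in> M" using s N_G G_diff level_M by blast
        hence e: "(z * y - 1) * (s - s') \<in> level K"
          using M_mult_level_K(2) quasi_inv_level(2)[OF yG] by (simp add: z_def)
        have "s - s' \<in> level K" if "y * (s - s') \<in> level K"
          using level_diff[OF G_mult_level(1)[OF zG that] e] by (simp add: algebra_simps)
        moreover have "y * (s - s') \<in> level K" if "s - s' \<in> level K"
          using G_mult_level(1)[OF yG that] .
        ultimately show ?thesis by (auto simp: cK right_diff_distrib[symmetric])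
      qed
    qed
    finally show "card (?c ` {b \<in> N. coset U (app b x) = coset U (app y x)}) = card (?c ` ?St)" .
  qed
  have fin_n: "finite (?c ` norm_alg)" by (intro finite_coset_level norm_alg_M)
  have "card (?c ` norm_alg) = card ((\<lambda>a. coset U (app a x)) ` norm_alg) * card (?c ` ?An)"
    using card_coset_image_tower[OF norm_alg_subgroup add_subgroup_level[of K] U,
        of "\<lambda>a. app a x" "\<lambda>a. a"] fin_n level_K_app[OF _ x] by simp
  moreover have "card (?c ` ?An) > 0"
  proof -
    have "0 \<in> ?An" using add_subgroup_zero[OF norm_alg_subgroup] add_subgroup_zero[OF U] by simp
    thus ?thesis using fin_n by (auto simp: card_gt_0_iff intro: finite_subset[OF _ fin_n])
  qed
  ultimately show ?thesis using eq_N card_N card_St by simp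
qed

lemma finite_coset_U:
  assumes A: "A \<subseteq> V" shows "finite (coset U ` A)"
proof (rule finite_image_if_factors[OF finite_subset[OF image_mono[OF A] finite_V[of n]]])
  fix x y assume "coset (multiples (q ^ n) V) x = coset (multiples (q ^ n) V) y"
  hence "x - y \<in> U" using VU by (auto simp: coset_eq_iff[OF add_subgroup_multiples[OF V]])
  thus "coset U x = coset U y" by (simp add: coset_eq_iff[OF U])
qed

lemma finite_coset_app: "A \<subseteq> M \<Longrightarrow> x \<in> V \<Longrightarrow> finite ((\<lambda>a. coset U (app a x)) ` A)"
  using finite_coset_U[of "(\<lambda>a. app a x) ` A"] M_V by (auto simp: image_image)

lemma card_h_dvd_card_norm_alg:
  assumes x: "x \<in> V"
  shows "card ((\<lambda>a. coset U (app a x)) ` h) dvd card ((\<lambda>a. coset U (app a x)) ` norm_alg)"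
proof -
  let ?hx = "(\<lambda>a. app a x) ` h" and ?f = "\<lambda>a. coset U (app a x)"
  have hx: "add_subgroup ?hx"
    by (rule add_subgroupI)
       (auto simp: app_minus[symmetric] simp del: app_minus 
         intro!: imageI add_subgroup_diff[OF h] intro: rev_image_eqI[OF add_subgroup_zero[OF h]])
  have "card (?f ` norm_alg) = card ((\<lambda>a. coset (?hx + U) (app a x)) ` norm_alg) *
          card (?f ` {a \<in> norm_alg. app a x \<in> ?hx + U})"
  proof (rule card_coset_image_tower[OF norm_alg_subgroup U add_subgroup_set_plus[OF hx U]])
    show "app a x \<in> ?hx + U" if "app a x \<in> U" for a
      using set_plus_intro[OF add_subgroup_zero[OF hx] that] by simp
    show "finite (?f ` norm_alg)" by (intro finite_coset_app norm_alg_M x)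
  qed simp_all
  also have "?f ` {a \<in> norm_alg. app a x \<in> ?hx + U} = ?f ` h"
  proof (intro equalityI subsetI)
    fix t assume "t \<in> ?f ` {a \<in> norm_alg. app a x \<in> ?hx + U}"
    then obtain a b u where "t = ?f a" "b \<in> h" "u \<in> U" "app a x = app b x + u"
      by (auto elim!: set_plus_elim)
    thus "t \<in> ?f ` h" by (intro image_eqI[of _ _ b]) (simp_all add: coset_eq_iff[OF U])
  next
    fix t assume "t \<in> ?f ` h"
    then obtain b where b: "b \<in> h" "t = ?f b" by blast
    hence "app b x + 0 \<in> ?hx + U" by (intro set_plus_intro add_subgroup_zero[OF U]) auto
    thus "t \<in> ?f ` {a \<in> norm_alg. app a x \<in> ?hx + U}" using b h_norm_alg by auto
  qed
  finally show ?thesis by simp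
qed

lemma coset_image_h_eq_H:
  assumes x: "x \<in> V"
  shows "(\<lambda>a. coset U (app a x)) ` h = (\<lambda>a. coset U (app a x)) ` H"
proof (intro equalityI subsetI)
  fix t assume "t \<in> (\<lambda>a. coset U (app a x)) ` H"
  then obtain b m where "b \<in> h" "m \<in> level n" "t = coset U (app (b + m) x)"
    unfolding H_def by (blast elim: set_plus_elim)
  thus "t \<in> (\<lambda>a. coset U (app a x)) ` h"
    using level_n_app[OF _ x] by (intro image_eqI[of _ _ b]) (simp_all add: coset_eq_iff[OF U])
qed (use h_H in auto)

text \<open>
  Modulo \<open>U\<close>, \<open>Hyx \<subseteq> yHx\<close> because \<open>y\<close> normalises \<open>H\<close>. Equality of the two sizes follows by exchanging
  the roles of \<open>x\<close> and \<open>x'\<close>.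
\<close>

lemma card_h_le_of_orbit:
  assumes x: "x \<in> V" and x': "x' \<in> V" and y: "y \<in> N" "app y x - x' \<in> U"
  shows "card ((\<lambda>a. coset U (app a x')) ` h) \<le> card ((\<lambda>a. coset U (app a x)) ` h)"
proof -
  note cU = coset_eq_iff[OF U]
  have yG: "y \<in> G" using y N_G by blast
  let ?f = "\<lambda>a. coset U (app a x)" and ?g = "\<lambda>a. coset U (app y (app a x))"
  have "(\<lambda>a. coset U (app a x')) ` H \<subseteq> ?g ` H"
  proof safe
    fix b assume b: "b \<in> H"
    then obtain c where c: "c \<in> H" "b * y - y * (b + of_nat (q ^ 2) * c) \<in> level K"
      using y(1) unfolding N_def by blast
    let ?b = "b + of_nat (q ^ 2) * c"
    have "app (b * y - y * ?b) x - app b (app y x - x') \<in> U"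
      using level_K_app[OF c(2) x] M_U[OF _ y(2), of b] b H_M by (intro add_subgroup_diff[OF U]) auto
    hence "coset U (app b x') = ?g ?b" by (simp add: cU app_diff)
    moreover have "?b \<in> H" using b c by (intro add_subgroup_add[OF H] add_subgroup_of_nat_mult[OF H])
    ultimately show "coset U (app b x') \<in> ?g ` H" by blast
  qed
  moreover have "finite (?f ` H)" by (intro finite_coset_app H_M x)
  moreover have g: "?g a = ?g b" if "?f a = ?f b" for a b
    using G_U[OF yG, of "app a x - app b x"] that by (simp add: cU app_diff)
  moreover have "finite (?g ` H)"
  proof -
    have "(\<lambda>a. app y (app a x)) ` H \<subseteq> V" using H_M M_V G_V[OF yG] x by blast
    from finite_coset_U[OF this] show ?thesis by (simp add: image_image)
  qed
  ultimately have "card ((\<lambda>a. coset U (app a x')) ` H) \<le> card (?f ` H)"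
    by (meson card_image_le_card_image card_mono order_trans)
  thus ?thesis by (simp add: coset_image_h_eq_H x x')
qed

text \<open>
  On the orbit of \<open>x\<close> the summand is constant, so the orbit contributes \<open>|Nx| / |hx| = |\<n>x| / |hx|\<close>,
  an integer.
\<close>

theorem sum_inverse_card_in_Ints:
  assumes R: "transversal V U R"
  shows "(\<Sum>x\<in>R. 1 / rat_of_nat (card ((\<lambda>a. coset U (app a x)) ` h))) \<in> \<int>"
proof (rule sum_in_Ints_if_classes)
  let ?f = "\<lambda>x. card ((\<lambda>a. coset U (app a x)) ` h)"
  define E where "E x x' \<longleftrightarrow> (\<exists>y\<in>N. app y x - x' \<in> U)" for x x'
  have RV: "R \<subseteq> V" and "finite R" and inj: "inj_on (coset U) R" and img: "coset U ` R = coset U ` V"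
    using R by (auto simp: transversal_def)
  show "finite R" by fact
  show "E x x" for x using N_one add_subgroup_zero[OF U] unfolding E_def by (intro bexI[of _ 1]) simp_all
  have E_sym: "E x' x" if "x \<in> R" "x' \<in> R" "E x x'" for x x'
  proof -
    obtain y where y: "y \<in> N" "app y x - x' \<in> U" using \<open>E x x'\<close> by (auto simp: E_def)
    hence yG: "y \<in> G" using N_G by blast
    have "(app (quasi_inv y) (app y x) - x) - app (quasi_inv y) (app y x - x') \<in> U"
    proof (rule add_subgroup_diff[OF U])
      show "app (quasi_inv y) (app y x) - x \<in> U" using that RV by (intro quasi_inv_app yG) auto
      show "app (quasi_inv y) (app y x - x') \<in> U" by (intro G_U quasi_inv_G yG y)
    qed
    hence "app (quasi_inv y) x' - x \<in> U" by (simp add: app_diff)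
    thus ?thesis using N_quasi_inv[OF y(1)] by (auto simp: E_def)
  qed
  show "E x' x" if "x \<in> R" "x' \<in> R" "E x x'" for x x' by (rule E_sym[OF that])
  show "E x z" if E: "E x y" "E y z" for x y z
  proof -
    obtain g g' where g: "g \<in> N" "app g x - y \<in> U" "g' \<in> N" "app g' y - z \<in> U"
      using E by (auto simp: E_def)
    have "app g' (app g x - y) + (app g' y - z) \<in> U"
      using G_U[OF _ g(2), of g'] g N_G by (intro add_subgroup_add[OF U]) auto
    hence "app (g' * g) x - z \<in> U" by (simp add: app_diff)
    thus ?thesis using N_mult[OF g(3) g(1)] unfolding E_def by blast
  qed
  show "(\<Sum>x\<in>{x' \<in> R. E x x'}. 1 / rat_of_nat (?f x)) \<in> \<int>" if x: "x \<in> R" for x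
  proof -
    have "?f x' = ?f x" if "x' \<in> {x' \<in> R. E x x'}" for x'
      using E_sym[OF x, of x'] that RV x card_h_le_of_orbit unfolding E_def by (intro antisym) blast+
    hence sum_eq: "(\<Sum>x\<in>{x' \<in> R. E x x'}. 1 / rat_of_nat (?f x)) =
        rat_of_nat (card {x' \<in> R. E x x'}) / rat_of_nat (?f x)" by simp
    have "coset U ` {x' \<in> R. E x x'} = (\<lambda>y. coset U (app y x)) ` N"
    proof (intro equalityI subsetI)
      fix t assume "t \<in> coset U ` {x' \<in> R. E x x'}"
      then obtain x' y where "t = coset U x'" "y \<in> N" "app y x - x' \<in> U" by (auto simp: E_def)
      thus "t \<in> (\<lambda>y. coset U (app y x)) ` N" using coset_eq_iff[OF U] by blast
    next
      fix t assume "t \<in> (\<lambda>y. coset U (app y x)) ` N"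
      then obtain y where y: "y \<in> N" "t = coset U (app y x)" by blast
      hence "app y x \<in> V" using G_V N_G RV x by blast
      then obtain x' where "x' \<in> R" "app y x - x' \<in> U" by (rule transversal_obtain[OF R U])
      thus "t \<in> coset U ` {x' \<in> R. E x x'}"
        using y coset_eq_iff[OF U] by (auto simp: E_def intro!: image_eqI[of _ _ x'])
    qed
    hence "card {x' \<in> R. E x x'} = card ((\<lambda>y. coset U (app y x)) ` N)"
      using card_image[OF inj_on_subset[OF inj, of "{x' \<in> R. E x x'}"]] by simp
    also have "\<dots> = card ((\<lambda>a. coset U (app a x)) ` norm_alg)"
      using x RV by (intro card_orbit_eq_card_tangent) auto
    finally have "?f x dvd card {x' \<in> R. E x x'}" using card_h_dvd_card_norm_alg x RV by auto
    then obtain k where "card {x' \<in> R. E x x'} = ?f x * k" by (elim dvdE)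
    thus ?thesis unfolding sum_eq by (cases "?f x = 0") simp_all
  qed
qed

end

section \<open>Integrality of the sum over all vectors\<close>

context contracting_pair
begin

text \<open>
  The previous result for \<open>h = q\<^sup>2L\<close> and the sublattice \<open>q\<^sup>2U\<close>. Both scalings cancel in \<open>|hx|\<close>, and
  every class modulo \<open>U\<close> splits into \<open>|U / q\<^sup>2U|\<close> classes modulo \<open>q\<^sup>2U\<close> with the same summand.
\<close>

theorem sum_inverse_card_times_index_in_Ints:
  assumes U: "add_subgroup U" and UV: "U \<subseteq> V"
    and M_U: "\<And>f u. f \<in> M \<Longrightarrow> u \<in> U \<Longrightarrow> app f u \<in> U"
    and VU: "multiples (q ^ n) V \<subseteq> U"
    and L: "add_subgroup L" and LM: "L \<subseteq> M"
    and L_bracket: "\<And>a b. a \<in> L \<Longrightarrow> b \<in> L \<Longrightarrow> a * b - b * a \<in> L"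
    and R: "transversal V U R"
  shows "rat_of_nat (card (coset (multiples (q ^ 2) U) ` U)) *
           (\<Sum>x\<in>R. 1 / rat_of_nat (card ((\<lambda>a. coset U (app a x)) ` L))) \<in> \<int>"
proof -
  let ?U = "multiples (q ^ 2) U" and ?h = "multiples (q ^ 2) L"
  interpret scaled: lie_lattice q V M ?U "2 + n" ?h
  proof unfold_locales
    show "add_subgroup ?U" "add_subgroup ?h" using U L by (auto intro: add_subgroup_multiples)
    show "?U \<subseteq> V" using multiples_subset[OF U] UV by blast
    show "app f u \<in> ?U" if "f \<in> M" "u \<in> ?U" for f u
      using that M_U by (auto elim!: multiplesE simp: app_of_nat_mult intro!: multiplesI)
    show "multiples (q ^ (2 + n)) V \<subseteq> ?U"
      using multiples_mono[OF VU, of "q ^ 2"] by (simp only: multiples_multiples power_add)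
    show "?h \<subseteq> level 2" unfolding level_def by (intro multiples_mono LM)
    fix a b assume "a \<in> ?h" "b \<in> ?h"
    then obtain a' b' where ab: "a' \<in> L" "b' \<in> L" "a = of_nat (q ^ 2) * a'" "b = of_nat (q ^ 2) * b'"
      by (metis multiplesE)
    have "of_nat (q ^ 2) * x * (of_nat (q ^ 2) * y) = of_nat (q ^ 2) * (of_nat (q ^ 2) * (x * y))"
      for x y :: "'v endo" by (metis mult.assoc mult_of_nat_commute)
    hence "a * b - b * a = of_nat (q ^ 2) * (of_nat (q ^ 2) * (a' * b' - b' * a'))"
      by (simp only: ab right_diff_distrib)
    thus "a * b - b * a \<in> multiples (q ^ 2) ?h" using L_bracket[OF ab(1,2)] by (simp add: multiplesI)
  qed
  note cancel = of_nat_power_mult_cancel[OF torsion_free]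
  let ?f = "\<lambda>x. 1 / rat_of_nat (card ((\<lambda>a. coset U (app a x)) ` L))"
  obtain S where S: "transversal U ?U S" using ex_transversal[OF scaled.finite_coset_U[OF UV]] by blast
  \<comment> \<open>A class modulo \<open>q\<^sup>2U\<close> is given by its class modulo \<open>U\<close> and its position in the latter.\<close>
  define R' where "R' = (\<lambda>(r, s). r + s) ` (R \<times> S)"
  have RV: "R \<subseteq> V" and finR: "finite R" and SU: "S \<subseteq> U" and finS: "finite S"
    using R S by (auto simp: transversal_def)
  have U2U: "?U \<subseteq> U" by (intro multiples_subset U)
  have U2: "add_subgroup ?U" by (intro add_subgroup_multiples U)
  have eqD: "r = r' \<and> s = s'" 
    if "r \<in> R" "s \<in> S" "r' \<in> R" "s' \<in> S" "r + s - (r' + s') \<in> ?U" for r s r' s'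
  proof -
    have "(r + s - (r' + s')) - (s - s') \<in> U"
    proof (rule add_subgroup_diff[OF U])
      show "s - s' \<in> U" using that SU by (auto intro: add_subgroup_diff[OF U])
    qed (use that U2U in blast)
    hence "r = r'" using transversal_eqI[OF R U, of r r'] that by simp
    thus ?thesis using transversal_eqI[OF S U2, of s s'] that by simp
  qed
  have inj: "inj_on (\<lambda>(r, s). r + s) (R \<times> S)"
  proof (rule inj_onI, clarify)
    fix r s r' s' assume "r \<in> R" "s \<in> S" "r' \<in> R" "s' \<in> S" "r + s = r' + s'"
    thus "r = r' \<and> s = s'" using eqD[of r s r' s'] add_subgroup_zero[OF U2] by simp
  qed
  have "transversal V ?U R'"
    unfolding transversal_def
  proof (intro conjI)
    show "finite R'" using finR finS by (simp add: R'_def)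
    show R'V: "R' \<subseteq> V" using RV SU UV by (auto simp: R'_def intro!: add_subgroup_add[OF V])
    show "inj_on (coset ?U) R'"
    proof (rule inj_onI)
      fix x x' assume "x \<in> R'" "x' \<in> R'" "coset ?U x = coset ?U x'"
      moreover from this obtain r s r' s' where
        "r \<in> R" "s \<in> S" "r' \<in> R" "s' \<in> S" "x = r + s" "x' = r' + s'" by (auto simp: R'_def)
      ultimately show "x = x'" using eqD[of r s r' s'] by (simp add: coset_eq_iff[OF U2])
    qed
    show "coset ?U ` R' = coset ?U ` V"
    proof (intro equalityI subsetI)
      fix t assume "t \<in> coset ?U ` V"
      then obtain x where x: "x \<in> V" "t = coset ?U x" by blast
      obtain r where r: "r \<in> R" "x - r \<in> U" by (rule transversal_obtain[OF R U x(1)])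
      obtain s where s: "s \<in> S" "x - r - s \<in> ?U" by (rule transversal_obtain[OF S U2 r(2)])
      have "t = coset ?U (r + s)" using s x by (simp add: coset_eq_iff[OF U2] algebra_simps)
      moreover have "r + s \<in> R'" using r s by (auto simp: R'_def)
      ultimately show "t \<in> coset ?U ` R'" by blast
    qed (use R'V in auto)
  qed
  hence "(\<Sum>x\<in>R'. 1 / rat_of_nat (card ((\<lambda>a. coset ?U (app a x)) ` ?h))) \<in> \<int>"
    by (rule scaled.sum_inverse_card_in_Ints)
  also have "(\<Sum>x\<in>R'. 1 / rat_of_nat (card ((\<lambda>a. coset ?U (app a x)) ` ?h))) = (\<Sum>x\<in>R'. ?f x)"
  proof (rule sum.cong[OF refl])
    fix x
    have "of_nat (q ^ 2) * w \<in> ?U \<longleftrightarrow> w \<in> U" for w :: 'v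
      using cancel by (metis multiplesE multiplesI)
    hence "card ((\<lambda>a. coset ?U (of_nat (q ^ 2) * app a x)) ` L) = card ((\<lambda>a. coset U (app a x)) ` L)"
      by (intro card_image_eq_card_image) (simp add: coset_eq_iff U U2 right_diff_distrib[symmetric])
    thus "1 / rat_of_nat (card ((\<lambda>a. coset ?U (app a x)) ` ?h)) = ?f x"
      by (simp add: multiples_def image_image)
  qed
  also have "\<dots> = (\<Sum>(r, s)\<in>R \<times> S. ?f (r + s))"
    unfolding R'_def by (subst sum.reindex[OF inj]) (simp add: case_prod_unfold)
  also have "\<dots> = (\<Sum>(r, s)\<in>R \<times> S. ?f r)"
  proof (rule sum.cong[OF refl], clarify)
    fix r s assume "s \<in> S"
    hence "coset U (app a (r + s)) = coset U (app a r)" if "a \<in> L" for a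
      using M_U[of a s] that LM SU by (auto simp: coset_eq_iff[OF U] app_add)
    thus "?f (r + s) = ?f r" by (simp cong: image_cong)
  qed
  also have "\<dots> = rat_of_nat (card S) * (\<Sum>r\<in>R. ?f r)"
    by (simp add: sum.cartesian_product[symmetric] sum_distrib_left)
  finally show ?thesis by (simp add: card_transversal[OF S])
qed

text \<open>
  The pairs \<open>(a, x)\<close> with \<open>ax \<in> U\<close> are counted in two ways. For fixed \<open>x\<close> the
  annihilators form the kernel of \<open>a \<mapsto> ax mod U\<close>, whose index is \<open>|Lx mod U|\<close>. The subgroup \<open>J\<close> consists of
  the endomorphisms that vanish on \<open>V / U\<close>, so \<open>T\<close> represents \<open>L\<close> as acting on \<open>V / U\<close>.
\<close>

lemma average_kernel_eq_sum_inverse_card: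
  fixes U J
  defines "J \<equiv> {f. \<forall>x\<in>V. app f x \<in> U}"
  assumes U: "add_subgroup U" and L: "add_subgroup L"
    and R: "transversal V U R" and T: "transversal L J T"
  shows "(\<Sum>a\<in>T. rat_of_nat (card {x \<in> R. app a x \<in> U})) / rat_of_nat (card T) =
           (\<Sum>x\<in>R. 1 / rat_of_nat (card ((\<lambda>a. coset U (app a x)) ` L)))"
proof -
  have J: "add_subgroup J"
    by (rule add_subgroupI) (auto simp: J_def intro: add_subgroup_zero[OF U] add_subgroup_diff[OF U])
  have finT: "finite T" and finR: "finite R" and RV: "R \<subseteq> V" 
    using T R by (auto simp: transversal_def)
  have fin: "finite (coset J ` L)" using T finT by (metis transversal_def finite_imageI)
  have T0: "card T > 0"
    unfolding card_transversal[OF T] using fin add_subgroup_zero[OF L] by (auto simp: card_gt_0_iff)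
  have "(\<Sum>a\<in>T. rat_of_nat (card {x \<in> R. app a x \<in> U})) = 
        (\<Sum>a\<in>T. \<Sum>x\<in>R. if app a x \<in> U then 1 else 0)"
    using finR by (simp add: sum.If_cases Int_def)
  also have "\<dots> = (\<Sum>x\<in>R. \<Sum>a\<in>T. if app a x \<in> U then 1 else 0)" by (rule sum.swap)
  also have "\<dots> = (\<Sum>x\<in>R. rat_of_nat (card {a \<in> T. app a x \<in> U}))"
    using finT by (simp add: sum.If_cases Int_def)
  also have "\<dots> = (\<Sum>x\<in>R. rat_of_nat (card T) / rat_of_nat (card ((\<lambda>a. coset U (app a x)) ` L)))"
  proof (rule sum.cong[OF refl])
    fix x assume "x \<in> R"
    hence x: "x \<in> V" using RV by blast
    have "card {a \<in> T. app a x \<in> U} = card (coset J ` {a \<in> L. app a x \<in> U})"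
    proof (rule card_transversal_Collect[OF T J])
      fix a b assume "a - b \<in> J" "app a x \<in> U"
      hence "app a x - app (a - b) x \<in> U"
        using x by (intro add_subgroup_diff[OF U]) (auto simp: J_def)
      thus "app b x \<in> U" by simp
    qed
    moreover have "card (coset J ` L) = card ((\<lambda>a. coset U (app a x)) ` L) *
        card (coset J ` {a \<in> L. app a x \<in> U})"
      using card_coset_image_tower[OF L J U, of "\<lambda>a. app a x" "\<lambda>a. a"] fin x by (simp add: J_def)
    ultimately have "card T = card ((\<lambda>a. coset U (app a x)) ` L) * card {a \<in> T. app a x \<in> U}"
      by (simp add: card_transversal[OF T])
    thus "rat_of_nat (card {a \<in> T. app a x \<in> U}) =
      rat_of_nat (card T) / rat_of_nat (card ((\<lambda>a. coset U (app a x)) ` L))"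
      using T0 by (auto simp: field_simps)
  qed
  also have "\<dots> = rat_of_nat (card T) * (\<Sum>x\<in>R. 1 / rat_of_nat (card ((\<lambda>a. coset U (app a x)) ` L)))"
    by (simp add: sum_distrib_left)
  finally show ?thesis using T0 by simp
qed

end

section \<open>Matrices as endomorphisms of row vectors\<close>

text \<open>
  Right multiplication by the matrix \<open>a\<close> on row vectors. Vectors of length \<open>d\<close> are modelled as
  functions on the natural numbers, for the sake of a fixed type; the output vanishes beyond \<open>d\<close>.
\<close>

definition row_mult :: "nat \<Rightarrow> 'k::comm_ring_1 mat \<Rightarrow> (nat \<Rightarrow> 'k) endo" where
  "row_mult d a = Endo (\<lambda>x j. if j < d then \<Sum>i<d. x i * a $$ (i, j) else 0)"

lemma app_row_mult: "app (row_mult d a) x = (\<lambda>j. if j < d then \<Sum>i<d. x i * a $$ (i, j) else 0)"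
  unfolding row_mult_def by (subst app_Endo) (auto simp: fun_eq_iff algebra_simps sum.distrib)

lemma row_mult_minus:
  assumes "a \<in> carrier_mat d d" "b \<in> carrier_mat d d"
  shows "row_mult d (a - b) = row_mult d a - row_mult d b"
  using assms
  by (intro endo_eqI) (auto simp: app_row_mult fun_eq_iff algebra_simps sum_subtractf)

lemma row_mult_zero: "row_mult d (0\<^sub>m d d) = 0"
  by (intro endo_eqI) (auto simp: app_row_mult fun_eq_iff)

text \<open>
  Endomorphisms act on the left and matrices on the right, so products are reversed. The bracket of
  two endomorphisms then corresponds to the negative bracket of the matrices, and Lie
  subalgebras correspond to sets closed under the bracket.
\<close>

lemma row_mult_mult:
  assumes "a \<in> carrier_mat d d" "b \<in> carrier_mat d d"
  shows "row_mult d (a * b) = row_mult d b * row_mult d a"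
proof (intro endo_eqI ext)
  fix x :: "nat \<Rightarrow> 'a" and j
  show "app (row_mult d (a * b)) x j = app (row_mult d b * row_mult d a) x j"
  proof (cases "j < d")
    case True
    have "(\<Sum>i<d. x i * (a * b) $$ (i, j)) = (\<Sum>i<d. \<Sum>k<d. x i * a $$ (i, k) * b $$ (k, j))"
    proof (rule sum.cong[OF refl])
      fix i assume "i \<in> {..<d}"
      hence "(a * b) $$ (i, j) = (\<Sum>k<d. a $$ (i, k) * b $$ (k, j))"
        using True assms by (simp add: scalar_prod_def lessThan_atLeast0)
      thus "x i * (a * b) $$ (i, j) = (\<Sum>k<d. x i * a $$ (i, k) * b $$ (k, j))"
        by (simp add: sum_distrib_left mult.assoc)
    qed
    also have "\<dots> = (\<Sum>k<d. (\<Sum>i<d. x i * a $$ (i, k)) * b $$ (k, j))"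
      by (subst sum.swap) (simp add: sum_distrib_right)
    finally show ?thesis using True by (simp add: app_row_mult)
  qed (simp add: app_row_mult)
qed

definition unit_row :: "nat \<Rightarrow> nat \<Rightarrow> 'k::comm_ring_1" where
  "unit_row i = (\<lambda>j. if j = i then 1 else 0)"

lemma app_row_mult_unit_row:
  "i < d \<Longrightarrow> j < d \<Longrightarrow> app (row_mult d a) (unit_row i) j = a $$ (i, j)"
  by (simp add: app_row_mult unit_row_def if_distrib[of "\<lambda>t. t * _"] sum.delta cong: if_cong)

lemma row_mult_inj:
  assumes "a \<in> carrier_mat d d" "b \<in> carrier_mat d d" "row_mult d a = row_mult d b"
  shows "a = b"
  using assms(1,2) app_row_mult_unit_row[of _ d _ a] app_row_mult_unit_row[of _ d _ b] assms(3)
  by (intro eq_matI) auto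

section \<open>The valuation ring and its quotients\<close>

context nonarch_local_field
begin

lemma v_zero [simp]: "v 0 = 0"
  using eq_zero_iff[of 0] by simp

lemma v_one [simp]: "v 1 = 1"
  using mult[of 1 1] eq_zero_iff[of 1] by auto

lemma v_minus_one: "v (- 1) = 1"
  using mult[of "- 1" "- 1"] nonneg[of "- 1"] by (simp add: abs_square_eq_1 flip: power2_eq_square)

lemma v_uminus [simp]: "v (- x) = v x"
  using mult[of "- 1" x] v_minus_one by simp

lemma v_diff: "v x \<le> c \<Longrightarrow> v y \<le> c \<Longrightarrow> v (x - y) \<le> c"
  using ultrametric[of x "- y"] by simp

lemma v_add: "v x \<le> c \<Longrightarrow> v y \<le> c \<Longrightarrow> v (x + y) \<le> c"
  using ultrametric[of x y] by simp

lemma v_power: "v (x ^ n) = v x ^ n"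
  by (induction n) (auto simp: mult)

lemma v_inverse: "v (inverse x) = inverse (v x)"
  using mult[of x "inverse x"] by (cases "x = 0") (auto simp: eq_zero_iff field_simps)

lemma v_divide: "v (x / y) = v x / v y"
  by (simp add: divide_inverse mult v_inverse)

text \<open>
  The largest absolute value below \<open>1\<close>; its integral powers are the non-zero absolute values.
\<close>

definition rad :: real where
  "rad = (SOME r. 0 < r \<and> r < 1 \<and> v ` (UNIV - {0}) = range (\<lambda>k::int. r powi k))"

lemma rad: "0 < rad" "rad < 1"
  and v_image: "v ` (UNIV - {0}) = range (\<lambda>k::int. rad powi k)"
  using someI_ex[OF discrete] unfolding rad_def by blast+

lemma rad_power_le_1: "rad ^ n \<le> 1"
  using rad by (simp add: power_le_one)

lemma rad_power_pos: "0 < rad ^ n"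
  using rad by simp

lemma rad_power_mono: "k \<le> l \<Longrightarrow> rad ^ l \<le> rad ^ k"
  using rad by (simp add: power_decreasing)

lemma v_less_1_eq_rad_power:
  assumes "x \<noteq> 0" "v x < 1"
  shows "\<exists>e. v x = rad ^ Suc e"
proof -
  have "v x \<in> range (\<lambda>k::int. rad powi k)" unfolding v_image[symmetric] using assms(1) by simp
  then obtain k :: int where k: "v x = rad powi k" by blast
  have "k > 0"
  proof (rule ccontr)
    assume "\<not> k > 0"
    hence "rad powi k = inverse (rad ^ nat (- k))" by (simp add: power_int_def power_inverse)
    thus False using k assms(2) rad_power_le_1[of "nat (- k)"] rad_power_pos[of "nat (- k)"]
      by (simp add: field_simps)
  qed
  hence "v x = rad ^ Suc (nat k - 1)" using k by (simp add: power_int_def)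
  thus ?thesis by blast
qed

lemma v_less_1_iff: "v x < 1 \<longleftrightarrow> v x \<le> rad"
proof
  assume *: "v x < 1"
  show "v x \<le> rad"
  proof (cases "x = 0")
    case False
    then obtain e where "v x = rad ^ Suc e" using v_less_1_eq_rad_power * by blast
    thus ?thesis using rad_power_mono[of 1 "Suc e"] by simp
  qed (use rad in simp)
qed (use rad in auto)

definition uniformizer :: 'k where
  "uniformizer = (SOME x. v x = rad)"

lemma v_uniformizer: "v uniformizer = rad"
proof -
  have "rad powi 1 \<in> v ` (UNIV - {0})" unfolding v_image by (rule rangeI)
  hence "\<exists>x. v x = rad" by (metis imageE power_int_1_right)
  thus ?thesis unfolding uniformizer_def by (rule someI_ex)
qed

lemma uniformizer_nonzero: "uniformizer \<noteq> 0"
  using v_uniformizer rad by auto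

text \<open>
  The \<open>n\<close>-th power of the maximal ideal, as a ball.
\<close>

definition ideal_level :: "nat \<Rightarrow> 'k set" where
  "ideal_level n = {x. v x \<le> rad ^ n}"

lemma add_subgroup_ideal_level: "add_subgroup (ideal_level n)"
  by (rule add_subgroupI) (auto simp: ideal_level_def rad_power_pos less_imp_le intro: v_diff)

lemma carrier_valuation_ring: "carrier (valuation_ring v) = ideal_level 0"
  by (simp add: valuation_ring_def ideal_level_def)

lemma valuation_ideal_eq: "valuation_ideal v = ideal_level 1"
  by (simp add: valuation_ideal_def ideal_level_def v_less_1_iff)

lemma valuation_ring_simps:
  "x \<otimes>\<^bsub>valuation_ring v\<^esub> y = x * y" "x \<oplus>\<^bsub>valuation_ring v\<^esub> y = x + y"
  "\<one>\<^bsub>valuation_ring v\<^esub> = 1" "\<zero>\<^bsub>valuation_ring v\<^esub> = 0"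
  by (simp_all add: valuation_ring_def ring_of_type_algebra_def)

lemma cring_valuation_ring: "cring (valuation_ring v)"
proof (rule cringI)
  show "abelian_group (valuation_ring v)"
  proof (rule abelian_groupI, unfold carrier_valuation_ring valuation_ring_simps)
    fix x assume "x \<in> ideal_level 0"
    thus "\<exists>y\<in>ideal_level 0. y + x = 0" by (intro bexI[of _ "- x"]) (auto simp: ideal_level_def)
  qed (auto simp: ideal_level_def intro: v_add)
  show "comm_monoid (valuation_ring v)"
    by (rule comm_monoidI, unfold carrier_valuation_ring valuation_ring_simps)
       (auto simp: ideal_level_def mult mult_le_one nonneg)
qed (auto simp: valuation_ring_simps algebra_simps)

lemma ideal_power_eq: "ideal_power (valuation_ring v) (valuation_ideal v) n = ideal_level n"
proof (induction n)
  case (Suc n)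
  have "ideal_prod (valuation_ring v) (ideal_level 1) (ideal_level n) = ideal_level (Suc n)"
  proof (intro equalityI subsetI)
    fix x assume "x \<in> ideal_prod (valuation_ring v) (ideal_level 1) (ideal_level n)"
    thus "x \<in> ideal_level (Suc n)"
    proof (induction rule: ideal_prod.induct)
      case (prod i j)
      thus ?case using nonneg rad by (auto simp: ideal_level_def valuation_ring_simps mult intro!: mult_mono)
    next
      case (sum x y)
      thus ?case by (auto simp: ideal_level_def valuation_ring_simps intro: v_add)
    qed
  next
    fix x assume x: "x \<in> ideal_level (Suc n)"
    have "uniformizer \<otimes>\<^bsub>valuation_ring v\<^esub> (x / uniformizer) \<in> ideal_prod (valuation_ring v) (ideal_level 1) (ideal_level n)"
      using x rad by (intro ideal_prod.prod) (auto simp: ideal_level_def v_uniformizer v_divide field_simps)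
    thus "x \<in> ideal_prod (valuation_ring v) (ideal_level 1) (ideal_level n)"
      by (simp add: valuation_ring_simps uniformizer_nonzero)
  qed
  thus ?case using Suc by (simp add: valuation_ideal_eq)
qed (simp add: carrier_valuation_ring)

lemma ideal_ideal_level: "ideal (ideal_level n) (valuation_ring v)"
proof -
  interpret cring "valuation_ring v" by (rule cring_valuation_ring)
  have mem: "x * y \<in> ideal_level n" if "x \<in> ideal_level 0" "y \<in> ideal_level n" for x y
    using mult_mono[of "v x" 1 "v y" "rad ^ n"] that nonneg by (simp add: ideal_level_def mult)
  have mem': "y * x \<in> ideal_level n" if "x \<in> ideal_level 0" "y \<in> ideal_level n" for x y
    using mem[OF that] by (simp add: mult.commute)
  show ?thesis
  proof (rule idealI[OF ring_axioms])
    show "subgroup (ideal_level n) (add_monoid (valuation_ring v))"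
    proof (rule group.subgroupI[OF a_group])
      show "ideal_level n \<noteq> {}" using add_subgroup_zero[OF add_subgroup_ideal_level] by blast
      show "ideal_level n \<subseteq> carrier (add_monoid (valuation_ring v))"
        using rad_power_le_1[of n] by (auto simp: carrier_valuation_ring ideal_level_def)
    next
      fix x assume x: "x \<in> ideal_level n"
      hence "x \<in> ideal_level 0" using rad_power_le_1[of n] by (auto simp: ideal_level_def)
      hence "inv\<^bsub>add_monoid (valuation_ring v)\<^esub> x = - x"
        by (intro group.inv_equality[OF a_group])
           (auto simp: carrier_valuation_ring valuation_ring_simps ideal_level_def)
      thus "inv\<^bsub>add_monoid (valuation_ring v)\<^esub> x \<in> ideal_level n" using x by (simp add: ideal_level_def)
    next
      fix x y assume "x \<in> ideal_level n" "y \<in> ideal_level n"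
      thus "x \<otimes>\<^bsub>add_monoid (valuation_ring v)\<^esub> y \<in> ideal_level n"
        by (simp add: valuation_ring_simps ideal_level_def v_add)
    qed
  qed (use mem mem' in \<open>auto simp: valuation_ring_simps carrier_valuation_ring\<close>)
qed

lemma r_coset_eq_coset: "ideal_level n +>\<^bsub>valuation_ring v\<^esub> x = coset (ideal_level n) x"
  by (force simp: a_r_coset_def' valuation_ring_simps coset_def intro: exI[of _ "_ - x"])

lemma carrier_quotient: "carrier (valuation_ring v Quot ideal_level n) = coset (ideal_level n) ` ideal_level 0"
  by (auto simp: FactRing_def A_RCOSETS_def' carrier_valuation_ring r_coset_eq_coset)

text \<open>
  By induction: a class modulo the next power of the maximal ideal is determined by the class modulo
  the current one and a residue class, that of the difference to a fixed representative divided by a power of the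
  uniformiser.
\<close>

lemma finite_coset_ideal_level: "finite (coset (ideal_level n) ` ideal_level 0)"
proof (induction n)
  case 0
  have "finite ((\<lambda>x. ()) ` ideal_level 0)" by simp
  thus ?case
    by (rule finite_image_if_factors)
       (auto simp: coset_eq_iff[OF add_subgroup_ideal_level] intro: add_subgroup_diff[OF add_subgroup_ideal_level])
next
  case (Suc n)
  note cb = coset_eq_iff[OF add_subgroup_ideal_level]
  define rep where "rep = inv_into (ideal_level 0) (coset (ideal_level n))"
  define g where "g x = (coset (ideal_level n) x, 
      coset (ideal_level 1) ((x - rep (coset (ideal_level n) x)) / uniformizer ^ n))" for x
  have in0: "(x - rep (coset (ideal_level n) x)) / uniformizer ^ n \<in> ideal_level 0" if "x \<in> ideal_level 0" for x
  proof -
    have "coset (ideal_level n) x = coset (ideal_level n) (rep (coset (ideal_level n) x))"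
      unfolding rep_def using that by (simp add: f_inv_into_f)
    hence "x - rep (coset (ideal_level n) x) \<in> ideal_level n" unfolding cb .
    thus ?thesis using rad_power_pos[of n] by (simp add: ideal_level_def v_divide v_power v_uniformizer)
  qed
  have "finite (g ` ideal_level 0)"
  proof (rule finite_subset)
    show "g ` ideal_level 0 \<subseteq> (coset (ideal_level n) ` ideal_level 0) \<times> (coset (ideal_level 1) ` ideal_level 0)"
      using in0 by (auto simp: g_def)
    have "finite (coset (ideal_level 1) ` ideal_level 0)"
      using finite_residue_field by (simp add: valuation_ideal_eq carrier_quotient)
    thus "finite ((coset (ideal_level n) ` ideal_level 0) \<times> (coset (ideal_level 1) ` ideal_level 0))"
      using Suc by simp
  qed
  thus ?case
  proof (rule finite_image_if_factors)
    fix x y assume gxy: "g x = g y"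
    have "coset (ideal_level n) x = coset (ideal_level n) y"
      using arg_cong[OF gxy, of fst] by (simp only: g_def fst_conv)
    moreover have "coset (ideal_level 1) ((x - rep (coset (ideal_level n) x)) / uniformizer ^ n) =
       coset (ideal_level 1) ((y - rep (coset (ideal_level n) y)) / uniformizer ^ n)"
      using arg_cong[OF gxy, of snd] by (simp only: g_def snd_conv)
    ultimately have "(x - rep (coset (ideal_level n) x)) / uniformizer ^ n - (y - rep (coset (ideal_level n) x)) / uniformizer ^ n \<in> ideal_level 1"
      unfolding cb[symmetric] by metis
    hence "(x - y) / uniformizer ^ n \<in> ideal_level 1" by (simp add: diff_divide_distrib)
    hence "x - y \<in> ideal_level (Suc n)"
      using rad_power_pos[of n] by (simp add: ideal_level_def v_divide v_power v_uniformizer field_simps)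
    thus "coset (ideal_level (Suc n)) x = coset (ideal_level (Suc n)) y" by (simp only: cb)
  qed
qed

text \<open>
  Two natural numbers lie in the same residue class, because there are finitely many of these; their
  difference is the required integer.
\<close>

lemma ex_of_nat_in_valuation_ideal: "\<exists>q>0. v (of_nat q) < 1"
proof -
  note cb = coset_eq_iff[OF add_subgroup_ideal_level]
  have nat0: "of_nat n \<in> ideal_level 0" for n
    by (induction n) (auto simp: ideal_level_def intro: v_add)
  let ?f = "\<lambda>n::nat. coset (ideal_level 1) (of_nat n :: 'k)"
  have "finite (range ?f)"
    by (rule finite_subset[OF _ finite_coset_ideal_level[of 1]]) (use nat0 in auto)
  hence "\<not> inj ?f" using finite_imageD[of ?f UNIV] by auto
  then obtain i j where ij: "?f i = ?f j" "i < j"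
    unfolding inj_def by (metis linorder_neqE_nat)
  hence "v (of_nat j - of_nat i) \<le> rad"
    by (metis cb ideal_level_def mem_Collect_eq power_one_right)
  hence "v (of_nat (j - i)) < 1" using ij by (simp add: v_less_1_iff of_nat_diff)
  thus ?thesis using ij by (intro exI[of _ "j - i"]) simp
qed

section \<open>Lattices of row vectors and matrices\<close>

definition row_lattice :: "nat \<Rightarrow> nat \<Rightarrow> (nat \<Rightarrow> 'k) set" where
  "row_lattice d n = {x. (\<forall>i<d. x i \<in> ideal_level n) \<and> (\<forall>i\<ge>d. x i = 0)}"

definition mat_lattice :: "nat \<Rightarrow> nat \<Rightarrow> 'k mat set" where
  "mat_lattice d n = {a \<in> carrier_mat d d. \<forall>i<d. \<forall>j<d. a $$ (i, j) \<in> ideal_level n}"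

lemma carrier_matrix_module: "carrier (matrix_module (valuation_ring v) d) = mat_lattice d 0"
  unfolding matrix_module_def mat_lattice_def elements_mat_def
  by (auto simp: carrier_valuation_ring) (metis (no_types, lifting) UN_subset_iff atLeastLessThan_iff carrier_matD image_subset_iff zero_le)

lemma add_subgroup_row_lattice: "add_subgroup (row_lattice d n)"
  using add_subgroup_zero[OF add_subgroup_ideal_level] add_subgroup_diff[OF add_subgroup_ideal_level]
  by (intro add_subgroupI) (auto simp: row_lattice_def)

lemma ideal_level_mult: "x \<in> ideal_level m \<Longrightarrow> y \<in> ideal_level n \<Longrightarrow> x * y \<in> ideal_level (m + n)"
  using nonneg rad by (auto simp: ideal_level_def mult power_add intro!: mult_mono)

lemma app_row_mult_row_lattice: "a \<in> mat_lattice d n \<Longrightarrow> x \<in> row_lattice d m \<Longrightarrow> app (row_mult d a) x \<in> row_lattice d (m + n)"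
  unfolding row_lattice_def mat_lattice_def app_row_mult
  by (auto intro!: add_subgroup_sum[OF add_subgroup_ideal_level] ideal_level_mult)

lemma ideal_level_mono: "m \<le> n \<Longrightarrow> ideal_level n \<subseteq> ideal_level m"
  using rad_power_mono by (fastforce simp: ideal_level_def)

lemma row_lattice_mono: "m \<le> n \<Longrightarrow> row_lattice d n \<subseteq> row_lattice d m"
  using ideal_level_mono by (auto simp: row_lattice_def)

lemma unit_row_in_row_lattice: "i < d \<Longrightarrow> unit_row i \<in> row_lattice d 0"
  by (auto simp: row_lattice_def unit_row_def ideal_level_def)

lemma finite_coset_row_lattice: "finite (coset (row_lattice d n) ` row_lattice d 0)"
proof -
  let ?g = "\<lambda>x. restrict (\<lambda>i. coset (ideal_level n) (x i)) {..<d}"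
  have "?g ` row_lattice d 0 \<subseteq> PiE {..<d} (\<lambda>_. coset (ideal_level n) ` ideal_level 0)"
    by (auto simp: row_lattice_def)
  hence "finite (?g ` row_lattice d 0)"
    by (rule finite_subset) (auto intro!: finite_PiE finite_coset_ideal_level)
  thus ?thesis
  proof (rule finite_image_if_factors)
    fix x y assume xy: "x \<in> row_lattice d 0" "y \<in> row_lattice d 0" "?g x = ?g y"
    have "x i - y i \<in> ideal_level n" if "i < d" for i
      using fun_cong[OF xy(3), of i] that by (simp add: coset_eq_iff[OF add_subgroup_ideal_level])
    hence "x - y \<in> row_lattice d n" using xy by (auto simp: row_lattice_def)
    thus "coset (row_lattice d n) x = coset (row_lattice d n) y" by (simp add: coset_eq_iff[OF add_subgroup_row_lattice])
  qed
qed

lemma add_subgroup_mat_lattice: "add_subgroup (row_mult d ` mat_lattice d n)"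
proof (rule add_subgroupI)
  have "0\<^sub>m d d \<in> mat_lattice d n"
    by (simp add: mat_lattice_def add_subgroup_zero[OF add_subgroup_ideal_level])
  thus "0 \<in> row_mult d ` mat_lattice d n" using row_mult_zero[of d] by (metis imageI)
next
  fix f g assume "f \<in> row_mult d ` mat_lattice d n" "g \<in> row_mult d ` mat_lattice d n"
  then obtain a b where ab: "a \<in> mat_lattice d n" "b \<in> mat_lattice d n" "f = row_mult d a" "g = row_mult d b" by blast
  have "a - b \<in> mat_lattice d n"
    using ab add_subgroup_diff[OF add_subgroup_ideal_level] by (auto simp: mat_lattice_def)
  moreover have "f - g = row_mult d (a - b)"
    using ab by (simp add: row_mult_minus mat_lattice_def)
  ultimately show "f - g \<in> row_mult d ` mat_lattice d n" by blast
qed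

lemma ideal_level_scale:
  assumes "v c = rad ^ m"
  shows "c * x \<in> ideal_level (n + m) \<longleftrightarrow> x \<in> ideal_level n"
proof -
  have "rad ^ (n + m) = rad ^ m * rad ^ n" by (simp add: power_add)
  thus ?thesis using rad_power_pos[of m] assms by (simp add: ideal_level_def mult)
qed

lemma v_of_nat_power:
  assumes "v (of_nat q) = rad ^ e" shows "v (of_nat (q ^ k)) = rad ^ (e * k)"
  by (simp add: of_nat_power v_power assms power_mult)

lemma nonzero_if_v_eq: "v c = rad ^ m \<Longrightarrow> c \<noteq> 0"
  using rad by auto

lemma multiples_row_lattice:
  assumes q: "v (of_nat q) = rad ^ e"
  shows "multiples (q ^ k) (row_lattice d n) = row_lattice d (n + e * k)"
proof (intro equalityI subsetI)
  note vq = v_of_nat_power[OF q, of k]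
  fix x assume "x \<in> multiples (q ^ k) (row_lattice d n)"
  then obtain y where "y \<in> row_lattice d n" "x = of_nat (q ^ k) * y" by (elim multiplesE)
  thus "x \<in> row_lattice d (n + e * k)" by (auto simp: row_lattice_def ideal_level_scale[OF vq])
next
  note vq = v_of_nat_power[OF q, of k]
  fix x assume x: "x \<in> row_lattice d (n + e * k)"
  define y where "y = (\<lambda>i. x i / of_nat (q ^ k))"
  have xy: "x = of_nat (q ^ k) * y" using nonzero_if_v_eq[OF vq] by (auto simp: y_def fun_eq_iff)
  have "y \<in> row_lattice d n" using x by (auto simp: row_lattice_def xy ideal_level_scale[OF vq] nonzero_if_v_eq[OF vq])
  thus "x \<in> multiples (q ^ k) (row_lattice d n)" unfolding xy by (rule multiplesI)
qed

lemma row_mult_mat_lattice_subset: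
  assumes q: "v (of_nat q) = rad ^ e"
  shows "row_mult d ` mat_lattice d (e * k) \<subseteq> multiples (q ^ k) (row_mult d ` mat_lattice d 0)"
proof safe
  note vq = v_of_nat_power[OF q, of k]
  fix a assume a: "a \<in> mat_lattice d (e * k)"
  define b where "b = map_mat (\<lambda>x. x / of_nat (q ^ k)) a"
  have ad: "a \<in> carrier_mat d d" using a by (simp add: mat_lattice_def)
  have "a $$ (i, j) = of_nat (q ^ k) * b $$ (i, j)" if "i < d" "j < d" for i j
    using that ad nonzero_if_v_eq[OF vq] by (simp add: b_def)
  hence ab: "\<And>i j. i < d \<Longrightarrow> j < d \<Longrightarrow> a $$ (i, j) = of_nat (q ^ k) * b $$ (i, j)" .
  have "b \<in> mat_lattice d 0"
    using a ideal_level_scale[OF vq, of _ 0] ab by (auto simp: mat_lattice_def b_def)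
  moreover have "row_mult d a = of_nat (q ^ k) * row_mult d b"
    by (intro endo_eqI) (auto simp: app_row_mult fun_eq_iff ab sum_distrib_left algebra_simps intro!: sum.cong)
  ultimately show "row_mult d a \<in> multiples (q ^ k) (row_mult d ` mat_lattice d 0)"
    by (simp add: multiplesI)
qed

text \<open>
  Finiteness of \<open>M / q\<^sup>kM\<close> is deduced from that of \<open>V / q\<^sup>kV\<close>: a matrix is determined modulo \<open>q\<^sup>k\<close> by
  its rows, the images of the unit vectors.
\<close>

lemma contracting_pair_mat_lattice:
  assumes q: "v (of_nat q) = rad ^ e"
  shows "contracting_pair q (row_lattice d 0) (row_mult d ` mat_lattice d 0)"
proof
  have q0: "of_nat q \<noteq> (0 :: 'k)" by (rule nonzero_if_v_eq[OF q])
  show "\<forall>x :: nat \<Rightarrow> 'k. of_nat q * x = 0 \<longrightarrow> x = 0"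
    using q0 by (auto simp: fun_eq_iff)
  show "add_subgroup (row_lattice d 0)" by (rule add_subgroup_row_lattice)
  show M: "add_subgroup (row_mult d ` mat_lattice d 0)" by (rule add_subgroup_mat_lattice)
  show "f * g \<in> row_mult d ` mat_lattice d 0" if fg: "f \<in> row_mult d ` mat_lattice d 0" "g \<in> row_mult d ` mat_lattice d 0" for f g
  proof -
    obtain a b where ab: "a \<in> mat_lattice d 0" "b \<in> mat_lattice d 0" "f = row_mult d a" "g = row_mult d b" using fg by blast
    have "b * a \<in> mat_lattice d 0"
    proof -
      have "(b * a) $$ (i, j) \<in> ideal_level 0" if "i < d" "j < d" for i j
        using ab that ideal_level_mult[of _ 0 _ 0]
        by (auto simp: mat_lattice_def scalar_prod_def intro!: add_subgroup_sum[OF add_subgroup_ideal_level])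
      thus ?thesis using ab mult_carrier_mat[of b d d a d] by (simp add: mat_lattice_def)
    qed
    moreover have "f * g = row_mult d (b * a)" using ab by (simp add: row_mult_mult mat_lattice_def)
    ultimately show ?thesis by blast
  qed
  show "app f x \<in> row_lattice d 0" if "f \<in> row_mult d ` mat_lattice d 0" "x \<in> row_lattice d 0" for f x
    using that app_row_mult_row_lattice[of _ d 0 x 0] by auto
  fix k
  show "finite (coset (multiples (q ^ k) (row_lattice d 0)) ` row_lattice d 0)"
    by (simp add: multiples_row_lattice[OF q] finite_coset_row_lattice)
  let ?g = "\<lambda>f. restrict (\<lambda>i. coset (row_lattice d (e * k)) (app f (unit_row i))) {..<d}"
  have "?g ` row_mult d ` mat_lattice d 0 \<subseteq> PiE {..<d} (\<lambda>_. coset (row_lattice d (e * k)) ` row_lattice d 0)"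
    using app_row_mult_row_lattice[of _ d 0 _ 0] unit_row_in_row_lattice by fastforce
  hence "finite (?g ` row_mult d ` mat_lattice d 0)"
    by (rule finite_subset) (auto intro!: finite_PiE finite_coset_row_lattice)
  thus "finite (coset (multiples (q ^ k) (row_mult d ` mat_lattice d 0)) ` row_mult d ` mat_lattice d 0)"
  proof (rule finite_image_if_factors)
    fix f g assume "f \<in> row_mult d ` mat_lattice d 0" "g \<in> row_mult d ` mat_lattice d 0" and eq: "?g f = ?g g"
    then obtain a b where ab: "a \<in> mat_lattice d 0" "b \<in> mat_lattice d 0" "f = row_mult d a" "g = row_mult d b" by blast
    have "a $$ (i, j) - b $$ (i, j) \<in> ideal_level (e * k)" if "i < d" "j < d" for i j
    proof -
      have "app f (unit_row i) - app g (unit_row i) \<in> row_lattice d (e * k)"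
        using fun_cong[OF eq, of i] that by (simp add: coset_eq_iff[OF add_subgroup_row_lattice])
      hence "(app f (unit_row i) - app g (unit_row i)) j \<in> ideal_level (e * k)"
        using that by (simp add: row_lattice_def)
      thus ?thesis using that by (simp add: ab app_row_mult_unit_row)
    qed
    hence "a - b \<in> mat_lattice d (e * k)" using ab by (auto simp: mat_lattice_def)
    hence "row_mult d (a - b) \<in> multiples (q ^ k) (row_mult d ` mat_lattice d 0)"
      using row_mult_mat_lattice_subset[OF q] by blast
    moreover have "f - g = row_mult d (a - b)" using ab by (simp add: row_mult_minus mat_lattice_def)
    ultimately show "coset (multiples (q ^ k) (row_mult d ` mat_lattice d 0)) f =
        coset (multiples (q ^ k) (row_mult d ` mat_lattice d 0)) g"
      by (simp add: coset_eq_iff[OF add_subgroup_multiples[OF M]])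
  qed
qed

section \<open>Kernels over the quotient rings\<close>

lemma quotient_simps:
  defines "Q n \<equiv> valuation_ring v Quot ideal_level n"
  assumes "x \<in> ideal_level 0" "y \<in> ideal_level 0"
  shows "coset (ideal_level n) x \<oplus>\<^bsub>Q n\<^esub> coset (ideal_level n) y = coset (ideal_level n) (x + y)"
    and "coset (ideal_level n) x \<otimes>\<^bsub>Q n\<^esub> coset (ideal_level n) y = coset (ideal_level n) (x * y)"
proof -
  note h = ideal.rcos_ring_hom[OF ideal_ideal_level[of n]]
  show "coset (ideal_level n) x \<oplus>\<^bsub>Q n\<^esub> coset (ideal_level n) y = coset (ideal_level n) (x + y)"
    "coset (ideal_level n) x \<otimes>\<^bsub>Q n\<^esub> coset (ideal_level n) y = coset (ideal_level n) (x * y)"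
    using Ring.ring_hom_add[OF h, of x y] Ring.ring_hom_mult[OF h, of x y] assms(2,3)
    by (simp_all add: Q_def r_coset_eq_coset carrier_valuation_ring valuation_ring_simps)
qed

lemma quotient_zero: "\<zero>\<^bsub>valuation_ring v Quot ideal_level n\<^esub> = coset (ideal_level n) 0"
  by (simp add: FactRing_def coset_def)

lemma finsum_quotient:
  fixes m :: nat
  assumes "\<And>i. i < m \<Longrightarrow> f i \<in> ideal_level 0"
  shows "(\<Oplus>\<^bsub>valuation_ring v Quot ideal_level n\<^esub>i\<in>{..<m}. coset (ideal_level n) (f i)) =
           coset (ideal_level n) (\<Sum>i<m. f i)"
  using assms
proof (induction m)
  case 0
  interpret Q: ring "valuation_ring v Quot ideal_level n"
    by (rule ideal.quotient_is_ring[OF ideal_ideal_level])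
  show ?case by (simp add: quotient_zero)
next
  case (Suc m)
  interpret Q: ring "valuation_ring v Quot ideal_level n"
    by (rule ideal.quotient_is_ring[OF ideal_ideal_level])
  have "(\<Oplus>\<^bsub>valuation_ring v Quot ideal_level n\<^esub>i\<in>{..<Suc m}. coset (ideal_level n) (f i)) =
     coset (ideal_level n) (f m) \<oplus>\<^bsub>valuation_ring v Quot ideal_level n\<^esub> coset (ideal_level n) (\<Sum>i<m. f i)"
    unfolding lessThan_Suc using Suc by (subst Q.finsum_insert) (auto simp: carrier_quotient)
  also have "\<dots> = coset (ideal_level n) (\<Sum>i<Suc m. f i)"
    using Suc.prems by (subst quotient_simps)
      (auto simp: add.commute intro: add_subgroup_sum[OF add_subgroup_ideal_level])
  finally show ?case .
qed

definition reduce_row :: "nat \<Rightarrow> nat \<Rightarrow> (nat \<Rightarrow> 'k) \<Rightarrow> 'k set vec" where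
  "reduce_row d n x = vec d (\<lambda>i. coset (ideal_level n) (x i))"

lemma reduce_row_eq_iff:
  assumes "x \<in> row_lattice d 0" "y \<in> row_lattice d 0"
  shows "reduce_row d n x = reduce_row d n y \<longleftrightarrow> x - y \<in> row_lattice d n"
  using assms unfolding reduce_row_def
  by (auto simp: row_lattice_def vec_eq_iff coset_eq_iff[OF add_subgroup_ideal_level])

lemma quotient_level_eq: "quotient_level v n = valuation_ring v Quot ideal_level n"
  by (simp add: quotient_level_def ideal_power_eq)

lemma reduction_eq: "reduction v n a = map_mat (coset (ideal_level n)) a"
  by (simp add: reduction_def ideal_power_eq r_coset_eq_coset)

text \<open>
  Lifting vectors over the quotient ring to vectors over the valuation ring turns the equation
  \<open>xa = 0\<close> into the congruence \<open>xa \<in> V\<^sub>n\<close>.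
\<close>

lemma left_kernel_reduction:
  assumes a: "a \<in> mat_lattice d 0"
  shows "left_kernel (quotient_level v n) d (reduction v n a) =
           reduce_row d n ` {x \<in> row_lattice d 0. app (row_mult d a) x \<in> row_lattice d n}"
proof -
  let ?Q = "valuation_ring v Quot ideal_level n"
  have prod_sum: "(\<Oplus>\<^bsub>?Q\<^esub>i\<in>{..<d}. coset (ideal_level n) (x i) \<otimes>\<^bsub>?Q\<^esub> (reduction v n a $$ (i, j))) = \<zero>\<^bsub>?Q\<^esub>
      \<longleftrightarrow> app (row_mult d a) x j \<in> ideal_level n" if x: "\<And>i. i < d \<Longrightarrow> x i \<in> ideal_level 0" and j: "j < d" for x j
  proof -
    interpret Q: ring ?Q by (rule ideal.quotient_is_ring[OF ideal_ideal_level])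
    have in0: "x i * a $$ (i, j) \<in> ideal_level 0" if "i < d" for i
      using ideal_level_mult[of "x i" 0 "a $$ (i, j)" 0] a x that j by (simp add: mat_lattice_def)
    have "(\<Oplus>\<^bsub>?Q\<^esub>i\<in>{..<d}. coset (ideal_level n) (x i) \<otimes>\<^bsub>?Q\<^esub> (reduction v n a $$ (i, j))) =
          (\<Oplus>\<^bsub>?Q\<^esub>i\<in>{..<d}. coset (ideal_level n) (x i * a $$ (i, j)))"
      using a x j in0
      by (intro Q.finsum_cong') (auto simp: reduction_eq mat_lattice_def quotient_simps carrier_quotient)
    also have "\<dots> = coset (ideal_level n) (\<Sum>i<d. x i * a $$ (i, j))"
      using in0 by (intro finsum_quotient)
    finally show ?thesis
      using j by (simp add: quotient_zero coset_eq_iff[OF add_subgroup_ideal_level] app_row_mult)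
  qed
  show ?thesis
  proof (intro equalityI subsetI)
    fix w assume "w \<in> left_kernel (quotient_level v n) d (reduction v n a)"
    hence w: "w \<in> carrier_vec d" "\<And>i. i < d \<Longrightarrow> w $ i \<in> carrier ?Q"
      and ker: "\<And>j. j < d \<Longrightarrow> (\<Oplus>\<^bsub>?Q\<^esub>i\<in>{..<d}. w $ i \<otimes>\<^bsub>?Q\<^esub> (reduction v n a $$ (i, j))) = \<zero>\<^bsub>?Q\<^esub>"
      by (auto simp: left_kernel_def quotient_level_eq)
    have "\<forall>i. \<exists>t. i < d \<longrightarrow> t \<in> ideal_level 0 \<and> w $ i = coset (ideal_level n) t"
      using w(2) unfolding carrier_quotient by blast
    then obtain t where t: "\<And>i. i < d \<Longrightarrow> t i \<in> ideal_level 0 \<and> w $ i = coset (ideal_level n) (t i)" by metis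
    define x where "x = (\<lambda>i. if i < d then t i else 0)"
    have x: "x \<in> row_lattice d 0" using t by (simp add: row_lattice_def x_def)
    have wx: "w = reduce_row d n x" using w(1) t by (intro eq_vecI) (auto simp: reduce_row_def x_def)
    have "app (row_mult d a) x j \<in> ideal_level n" if "j < d" for j
    proof -
      interpret Q: ring ?Q by (rule ideal.quotient_is_ring[OF ideal_ideal_level])
      have eq: "w $ i \<otimes>\<^bsub>?Q\<^esub> (reduction v n a $$ (i, j)) = 
            coset (ideal_level n) (x i) \<otimes>\<^bsub>?Q\<^esub> (reduction v n a $$ (i, j))" if "i \<in> {..<d}" for i
        using t that by (simp add: x_def)
      have mem: "coset (ideal_level n) (x i) \<otimes>\<^bsub>?Q\<^esub> (reduction v n a $$ (i, j)) \<in> carrier ?Q" if "i \<in> {..<d}" for i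
        using x a that \<open>j < d\<close> by (intro Q.m_closed) (auto simp: carrier_quotient row_lattice_def mat_lattice_def reduction_eq)
      have "(\<Oplus>\<^bsub>?Q\<^esub>i\<in>{..<d}. w $ i \<otimes>\<^bsub>?Q\<^esub> (reduction v n a $$ (i, j))) =
            (\<Oplus>\<^bsub>?Q\<^esub>i\<in>{..<d}. coset (ideal_level n) (x i) \<otimes>\<^bsub>?Q\<^esub> (reduction v n a $$ (i, j)))"
        using eq mem by (intro Q.finsum_cong') auto
      thus ?thesis using prod_sum[of x j] ker[OF that] x that by (simp add: row_lattice_def)
    qed
    hence "app (row_mult d a) x \<in> row_lattice d n" by (simp add: row_lattice_def app_row_mult)
    thus "w \<in> reduce_row d n ` {x \<in> row_lattice d 0. app (row_mult d a) x \<in> row_lattice d n}"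
      using wx x by blast
  next
    fix w assume "w \<in> reduce_row d n ` {x \<in> row_lattice d 0. app (row_mult d a) x \<in> row_lattice d n}"
    then obtain x where x: "x \<in> row_lattice d 0" "app (row_mult d a) x \<in> row_lattice d n" "w = reduce_row d n x" by blast
    show "w \<in> left_kernel (quotient_level v n) d (reduction v n a)"
      unfolding left_kernel_def quotient_level_eq
    proof (intro CollectI conjI allI impI)
      show "w \<in> carrier_vec d" by (simp add: x reduce_row_def)
      show "w $ i \<in> carrier ?Q" if "i < d" for i
        using that x by (auto simp: carrier_quotient reduce_row_def row_lattice_def)
      fix j assume j: "j < d"
      interpret Q: ring ?Q by (rule ideal.quotient_is_ring[OF ideal_ideal_level])
      have mem: "coset (ideal_level n) (x i) \<otimes>\<^bsub>?Q\<^esub> (reduction v n a $$ (i, j)) \<in> carrier ?Q" if "i \<in> {..<d}" for i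
        using x a that j by (intro Q.m_closed) (auto simp: carrier_quotient row_lattice_def mat_lattice_def reduction_eq)
      have "(\<Oplus>\<^bsub>?Q\<^esub>i\<in>{..<d}. w $ i \<otimes>\<^bsub>?Q\<^esub> (reduction v n a $$ (i, j))) =
            (\<Oplus>\<^bsub>?Q\<^esub>i\<in>{..<d}. coset (ideal_level n) (x i) \<otimes>\<^bsub>?Q\<^esub> (reduction v n a $$ (i, j)))"
        using mem by (intro Q.finsum_cong') (auto simp: x(3) reduce_row_def)
      thus "(\<Oplus>\<^bsub>?Q\<^esub>i\<in>{..<d}. w $ i \<otimes>\<^bsub>?Q\<^esub> (reduction v n a $$ (i, j))) = \<zero>\<^bsub>?Q\<^esub>"
        using prod_sum[of x j] x j by (simp add: row_lattice_def)
    qed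
  qed
qed

lemma reduction_eq_iff:
  assumes "a \<in> mat_lattice d 0" "b \<in> mat_lattice d 0"
  shows "reduction v n a = reduction v n b \<longleftrightarrow>
         (\<forall>x\<in>row_lattice d 0. app (row_mult d a - row_mult d b) x \<in> row_lattice d n)"
proof -
  have ab: "a \<in> carrier_mat d d" "b \<in> carrier_mat d d" using assms by (auto simp: mat_lattice_def)
  have "reduction v n a = reduction v n b \<longleftrightarrow> a - b \<in> mat_lattice d n"
    unfolding reduction_eq using ab
    by (auto simp: mat_eq_iff mat_lattice_def coset_eq_iff[OF add_subgroup_ideal_level])
  also have "\<dots> \<longleftrightarrow> (\<forall>x\<in>row_lattice d 0. app (row_mult d (a - b)) x \<in> row_lattice d n)"
  proof
    assume "a - b \<in> mat_lattice d n"
    thus "\<forall>x\<in>row_lattice d 0. app (row_mult d (a - b)) x \<in> row_lattice d n"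
      using app_row_mult_row_lattice[of "a - b" d n _ 0] by simp
  next
    assume *: "\<forall>x\<in>row_lattice d 0. app (row_mult d (a - b)) x \<in> row_lattice d n"
    have "(a - b) $$ (i, j) \<in> ideal_level n" if "i < d" "j < d" for i j
    proof -
      have "app (row_mult d (a - b)) (unit_row i) \<in> row_lattice d n" using * unit_row_in_row_lattice that by blast
      hence "app (row_mult d (a - b)) (unit_row i) j \<in> ideal_level n" using that by (simp add: row_lattice_def)
      thus ?thesis using that by (simp only: app_row_mult_unit_row)
    qed
    thus "a - b \<in> mat_lattice d n" using ab by (simp add: mat_lattice_def minus_carrier_mat)
  qed
  finally show ?thesis using ab by (simp add: row_mult_minus)
qed

lemma card_left_kernel_reduction:
  assumes a: "a \<in> mat_lattice d 0" and R: "transversal (row_lattice d 0) (row_lattice d n) R"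
  shows "card (left_kernel (quotient_level v n) d (reduction v n a)) =
           card {x \<in> R. app (row_mult d a) x \<in> row_lattice d n}"
proof -
  have "card (left_kernel (quotient_level v n) d (reduction v n a)) =
        card (coset (row_lattice d n) ` {x \<in> row_lattice d 0. app (row_mult d a) x \<in> row_lattice d n})"
    unfolding left_kernel_reduction[OF a]
    by (intro card_image_eq_card_image) (simp add: reduce_row_eq_iff coset_eq_iff[OF add_subgroup_row_lattice])
  also have "\<dots> = card {x \<in> R. app (row_mult d a) x \<in> row_lattice d n}"
  proof (rule card_transversal_Collect[OF R add_subgroup_row_lattice, symmetric])
    fix x y assume "x - y \<in> row_lattice d n" "app (row_mult d a) x \<in> row_lattice d n"
    hence "app (row_mult d a) x - app (row_mult d a) (x - y) \<in> row_lattice d n"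
      using app_row_mult_row_lattice[OF a, of "x - y" n] by (intro add_subgroup_diff[OF add_subgroup_row_lattice]) auto
    thus "app (row_mult d a) y \<in> row_lattice d n" by (simp add: app_diff)
  qed
  finally show ?thesis .
qed

section \<open>Bounded denominators\<close>

lemma lie_subalgebra_row_mult:
  assumes "lie_subalgebra_gl (valuation_ring v) d L"
  shows "L \<subseteq> mat_lattice d 0" and "add_subgroup (row_mult d ` L)"
    and "f \<in> row_mult d ` L \<Longrightarrow> g \<in> row_mult d ` L \<Longrightarrow> f * g - g * f \<in> row_mult d ` L"
proof -
  have sub: "submodule L (valuation_ring v) (matrix_module (valuation_ring v) d)"
    and br: "\<And>a b. a \<in> L \<Longrightarrow> b \<in> L \<Longrightarrow> a * b - b * a \<in> L"
    using assms by (auto simp: lie_subalgebra_gl_def)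
  have subg: "subgroup L (add_monoid (matrix_module (valuation_ring v) d))"
    using sub by (simp add: submodule_def)
  show L: "L \<subseteq> mat_lattice d 0"
    using subgroup.subset[OF subg] by (simp add: carrier_matrix_module)
  have mm: "0\<^sub>m d d = \<one>\<^bsub>add_monoid (matrix_module (valuation_ring v) d)\<^esub>"
    "x \<oplus>\<^bsub>matrix_module (valuation_ring v) d\<^esub> y = x + y"
    "c \<odot>\<^bsub>matrix_module (valuation_ring v) d\<^esub> x = c \<cdot>\<^sub>m x" for x y c
    by (simp_all add: matrix_module_def module_mat_def)
  have zero: "0\<^sub>m d d \<in> L" unfolding mm(1) by (rule subgroup.one_closed[OF subg])
  have diff: "a - b \<in> L" if "a \<in> L" "b \<in> L" for a b
  proof -
    have "(- 1) \<odot>\<^bsub>matrix_module (valuation_ring v) d\<^esub> b \<in> L"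
      using that by (intro submodule.smult_closed[OF sub])
        (simp_all add: carrier_valuation_ring ideal_level_def)
    hence "a + (- 1) \<cdot>\<^sub>m b \<in> L"
      using subgroup.m_closed[OF subg that(1)] by (simp add: mm)
    moreover have "a + (- 1) \<cdot>\<^sub>m b = a - b"
      using that L by (intro eq_matI) (auto simp: mat_lattice_def)
    ultimately show ?thesis by simp
  qed
  have car: "a \<in> carrier_mat d d" if "a \<in> L" for a using that L by (auto simp: mat_lattice_def)
  show "add_subgroup (row_mult d ` L)"
  proof (rule add_subgroupI)
    show "0 \<in> row_mult d ` L" using zero row_mult_zero[of d] by (metis imageI)
    fix f g assume "f \<in> row_mult d ` L" "g \<in> row_mult d ` L"
    thus "f - g \<in> row_mult d ` L"
      using diff by (auto simp: row_mult_minus[symmetric] car)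
  qed
  show "f * g - g * f \<in> row_mult d ` L" if fg: "f \<in> row_mult d ` L" "g \<in> row_mult d ` L"
  proof -
    obtain a b where ab: "a \<in> L" "b \<in> L" "f = row_mult d a" "g = row_mult d b" using fg by blast
    have "f * g - g * f = row_mult d (b * a - a * b)"
      using ab car[of a] car[of b]
      by (simp add: row_mult_mult row_mult_minus mult_carrier_mat[of _ d d _ d])
    thus ?thesis using br ab by simp
  qed
qed

text \<open>
  Multiplication by the \<open>n\<close>-th power of the uniformiser identifies the two quotients. This is why the
  denominator does not depend on \<open>n\<close>.
\<close>

lemma card_coset_row_lattice:
  "card (coset (row_lattice d (n + m)) ` row_lattice d n) = card (coset (row_lattice d m) ` row_lattice d 0)"
proof -
  have vn: "v (uniformizer ^ n) = rad ^ n" by (simp add: v_power v_uniformizer)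
  define \<mu> where "\<mu> x = (\<lambda>i::nat. uniformizer ^ n * x i)" for x
  have \<mu>: "\<mu> x \<in> row_lattice d (n + k) \<longleftrightarrow> x \<in> row_lattice d k" for x k
    using ideal_level_scale[OF vn, of _ k] uniformizer_nonzero by (simp add: row_lattice_def \<mu>_def add.commute)
  have "\<mu> ` row_lattice d 0 = row_lattice d n"
  proof (intro equalityI subsetI)
    fix x assume x: "x \<in> row_lattice d n"
    define y where "y = (\<lambda>i. x i / uniformizer ^ n)"
    have xy: "x = \<mu> y" by (simp add: \<mu>_def y_def uniformizer_nonzero)
    moreover have "y \<in> row_lattice d 0" using \<mu>[of y 0] x unfolding xy by simp
    ultimately show "x \<in> \<mu> ` row_lattice d 0" by blast
  qed (use \<mu>[of _ 0] in auto)
  hence "card (coset (row_lattice d (n + m)) ` row_lattice d n) = card ((\<lambda>x. coset (row_lattice d (n + m)) (\<mu> x)) ` row_lattice d 0)"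
    by (metis image_image)
  also have "\<dots> = card (coset (row_lattice d m) ` row_lattice d 0)"
  proof (rule card_image_eq_card_image)
    fix x y
    have "\<mu> x - \<mu> y = \<mu> (x - y)" by (auto simp: \<mu>_def fun_eq_iff right_diff_distrib)
    thus "(coset (row_lattice d (n + m)) (\<mu> x) = coset (row_lattice d (n + m)) (\<mu> y)) = (coset (row_lattice d m) x = coset (row_lattice d m) y)"
      using \<mu> by (simp add: coset_eq_iff[OF add_subgroup_row_lattice])
  qed
  finally show ?thesis .
qed

text \<open>
  The average is first rewritten over a transversal \<open>T\<close> of \<open>L\<close> modulo the matrices that reduce to zero and a
  transversal \<open>R\<close> of the vectors; then the two abstract results on sums over \<open>R\<close> apply.
\<close>

theorem ask_reduction_denominator:
  assumes L: "lie_subalgebra_gl (valuation_ring v) d L"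
    and q: "v (of_nat q) = rad ^ Suc e"
  shows "rat_of_nat (card (coset (row_lattice d (2 * Suc e)) ` row_lattice d 0)) *
           ask (quotient_level v n) d (reduction v n ` L) \<in> \<int>"
proof -
  interpret contracting_pair q "row_lattice d 0" "row_mult d ` mat_lattice d 0"
    by (rule contracting_pair_mat_lattice[OF q])
  let ?U = "row_lattice d n" and ?L = "row_mult d ` L"
  let ?J = "{f. \<forall>x\<in>row_lattice d 0. app f x \<in> ?U}"
  let ?ker = "\<lambda>f R. {x \<in> R. app f x \<in> ?U}"
  note Lsub = lie_subalgebra_row_mult[OF L]
  have VU: "multiples (q ^ n) (row_lattice d 0) \<subseteq> ?U"
    unfolding multiples_row_lattice[OF q] by (intro row_lattice_mono) simp
  have U: "add_subgroup ?U" by (rule add_subgroup_row_lattice)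
  have J: "add_subgroup ?J"
    by (rule add_subgroupI) (auto intro: add_subgroup_zero[OF U] add_subgroup_diff[OF U])
  obtain R where R: "transversal (row_lattice d 0) ?U R"
    using ex_transversal[OF finite_coset_row_lattice] by blast
  have "finite (coset ?J ` ?L)"
  proof (rule finite_image_if_factors[OF finite_coset_level[of ?L n]])
    show "?L \<subseteq> row_mult d ` mat_lattice d 0" using Lsub(1) by blast
    fix f g assume "coset (level n) f = coset (level n) g"
    hence "f - g \<in> level n" by (simp add: coset_eq_iff[OF add_subgroup_level])
    hence "f - g \<in> ?J" using level_app VU by blast
    thus "coset ?J f = coset ?J g" by (simp only: coset_eq_iff[OF J])
  qed
  then obtain T where T: "transversal ?L ?J T" using ex_transversal by blast
  \<comment> \<open>The matrices behind \<open>T\<close>: reduction is injective on them and attains all its values on \<open>L\<close> there.\<close>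
  define T' where "T' = {a \<in> L. row_mult d a \<in> T}"
  have TT': "T = row_mult d ` T'" using T by (auto simp: T'_def transversal_def)
  have T'L: "T' \<subseteq> mat_lattice d 0" using Lsub(1) by (auto simp: T'_def)
  have inj: "inj_on (row_mult d) T'"
    using T'L by (intro inj_onI row_mult_inj) (auto simp: mat_lattice_def)
  have red_iff: "reduction v n a = reduction v n b \<longleftrightarrow> row_mult d a - row_mult d b \<in> ?J"
    if "a \<in> mat_lattice d 0" "b \<in> mat_lattice d 0" for a b
    using reduction_eq_iff[OF that, of n] by blast
  have inj_red: "inj_on (reduction v n) T'"
  proof (rule inj_onI)
    fix a b assume ab: "a \<in> T'" "b \<in> T'" "reduction v n a = reduction v n b"
    hence "row_mult d a - row_mult d b \<in> ?J" using red_iff T'L by blast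
    hence "row_mult d a = row_mult d b"
      using ab transversal_eqI[OF T J, of "row_mult d a" "row_mult d b"] by (auto simp: TT')
    thus "a = b" using inj ab by (auto dest: inj_onD)
  qed
  have red_img: "reduction v n ` L = reduction v n ` T'"
  proof (intro equalityI subsetI)
    fix t assume "t \<in> reduction v n ` L"
    then obtain a where a: "a \<in> L" "t = reduction v n a" by blast
    hence "row_mult d a \<in> ?L" by blast
    then obtain f where "f \<in> T" "row_mult d a - f \<in> ?J" by (rule transversal_obtain[OF T J])
    then obtain b where b: "b \<in> T'" "row_mult d a - row_mult d b \<in> ?J" using TT' by blast
    hence "t = reduction v n b" using red_iff[of a b] a Lsub(1) T'L by blast
    thus "t \<in> reduction v n ` T'" using b by blast
  qed (auto simp: T'_def)
  have "ask (quotient_level v n) d (reduction v n ` L) =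
      (\<Sum>a\<in>T'. rat_of_nat (card (left_kernel (quotient_level v n) d (reduction v n a)))) / rat_of_nat (card T')"
    unfolding ask_def red_img by (simp add: sum.reindex[OF inj_red] card_image[OF inj_red])
  also have "\<dots> = (\<Sum>a\<in>T'. rat_of_nat (card (?ker (row_mult d a) R))) / rat_of_nat (card T')"
    using T'L by (intro arg_cong2[of _ _ _ _ "(/)"] sum.cong refl arg_cong[of _ _ rat_of_nat]
        card_left_kernel_reduction[OF _ R]) auto
  also have "\<dots> = (\<Sum>f\<in>T. rat_of_nat (card (?ker f R))) / rat_of_nat (card T)"
    unfolding TT' by (simp add: sum.reindex[OF inj] card_image[OF inj])
  also have "\<dots> = (\<Sum>x\<in>R. 1 / rat_of_nat (card ((\<lambda>a. coset ?U (app a x)) ` ?L)))"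
    by (rule average_kernel_eq_sum_inverse_card[OF U Lsub(2) R T])
  finally have ask: "ask (quotient_level v n) d (reduction v n ` L) =
      (\<Sum>x\<in>R. 1 / rat_of_nat (card ((\<lambda>a. coset ?U (app a x)) ` ?L)))" .
  have "rat_of_nat (card (coset (multiples (q ^ 2) ?U) ` ?U)) *
      (\<Sum>x\<in>R. 1 / rat_of_nat (card ((\<lambda>a. coset ?U (app a x)) ` ?L))) \<in> \<int>"
  proof (rule sum_inverse_card_times_index_in_Ints[OF U _ _ VU Lsub(2) _ _ R])
    show "?U \<subseteq> row_lattice d 0" by (intro row_lattice_mono) simp
    show "app f u \<in> ?U" if "f \<in> row_mult d ` mat_lattice d 0" "u \<in> ?U" for f u
      using that app_row_mult_row_lattice[of _ d 0 u n] by auto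
    show "?L \<subseteq> row_mult d ` mat_lattice d 0" using Lsub(1) by blast
    show "a * b - b * a \<in> ?L" if "a \<in> ?L" "b \<in> ?L" for a b using that by (rule Lsub(3))
  qed
  moreover have "card (coset (multiples (q ^ 2) ?U) ` ?U) = card (coset (row_lattice d (2 * Suc e)) ` row_lattice d 0)"
    unfolding multiples_row_lattice[OF q] card_coset_row_lattice by (simp add: mult.commute)
  ultimately show ?thesis by (simp only: ask)
qed

end

theorem theorem1p6:
  fixes v :: "'k::field_char_0 \<Rightarrow> real"
    and d :: nat
    and L :: "'k mat set"
  assumes "nonarch_local_field v"
    and "lie_subalgebra_gl (valuation_ring v) d L"
  shows "bounded_denominators (ask_zeta v d L)"
proof -
  interpret nonarch_local_field v by fact
  obtain q :: nat where q: "q > 0" "v (of_nat q) < 1" using ex_of_nat_in_valuation_ideal by blast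
  \<comment> \<open>The exponent is positive, so \<open>q\<^sup>nV\<close> is contained in \<open>V\<^sub>n\<close> for every \<open>n\<close>.\<close>
  then obtain e where e: "v (of_nat q) = rad ^ Suc e"
    using v_less_1_eq_rad_power[of "of_nat q"] by auto
  define c where "c = card (coset (row_lattice d (2 * Suc e)) ` row_lattice d 0)"
  have "c > 0"
    unfolding c_def using finite_coset_row_lattice add_subgroup_zero[OF add_subgroup_row_lattice, of d 0] by (auto simp: card_gt_0_iff)
  moreover have "fps_nth (fps_const (of_int (int c)) * ask_zeta v d L) n \<in> \<int>" for n
    using ask_reduction_denominator[OF assms(2) e, of n] by (simp add: ask_zeta_def c_def)
  ultimately show ?thesis
    unfolding bounded_denominators_def by (intro exI[of _ "int c"]) simp
qed

end
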